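(* Fix any $\alpha\in[0,1]$ and any feasible profile $(D,H)$. Under the partial-enumeration data model $\mathfrak{D}_{\mathrm{part},\alpha}$ there exists a randomized generation algorithm $\mathcal{A}=\mathcal{A}_{\mathcal{B}_{\mathrm{KW}}}$ such that $\mu_{low}(\mathcal{A},D)\ge\alpha/2$ almost surely and, for every countable collection $\mathcal{L}$, $$\sup_{K\in\mathcal{L}}\ \sup_{X\in\mathfrak{D}_{\mathrm{part},\alpha}(K)} H_{\mathcal{A}}^{\mathcal{L},K,X}(t)\le H(t)\qquad\text{for all sufficiently large } t .$$
   Context: Game. Fix a countably infinite universe $U=(u_1,u_2,\dots)$ with a fixed bijective enumeration. A language is an infinite subset of $U$; its elements are listed in the order inherited from $U$, $K=(k_1,k_2,\dots)$, and $K_i=\{k_1,\dots,k_i\}$. A collection is a countable collection $\mathcal{L}=(L^1,L^2,\dots)$ of languages with a fixed enumeration. The adversary picks $K\in\mathcal{L}$ and an observation sequence $X=(x_1,x_2,\dots)\in\mathfrak{D}(K)$, where the data model $\mathfrak{D}$ specifies the admissible sequences in $U^{\mathbb{N}}$ for each language. A generator $\mathcal{A}$ knows $U$ and $\mathcal{L}$ and is given by (possibly randomized) maps $\mathcal{A}_t:U^t\to U$, $t\ge1$ (which may depend on $\mathcal{L}$); on $X$ it outputs $o_t=\mathcal{A}_t(x_1,\dots,x_t)$, where $o_t$ must differ from all of $o_1,\dots,o_{t-1}$ and $x_1,\dots,x_t$. Write $\mathcal{A}(X)=(o_1,o_2,\dots)$ and $\mathcal{A}(X)_t=\{o_1,\dots,o_t\}$.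 A generator is eventually consistent if on every admissible $X$ for every $K\in\mathcal{L}$ there is a finite $T$ with $o_t\in K$ for all $t\ge T$. Partial enumeration. $\mathfrak{D}_{\mathrm{part},\alpha}(K)$ is the set of sequences $X$ (repetitions allowed) with $x_t\in K$ for all $t$, with infinitely many distinct terms, and with $\liminf_{i\to\infty}|\{x_1,x_2,\dots\}\cap K_i|/i\ge\alpha$. Hallucination rate. $H_{\mathcal{A}}^{\mathcal{L},K,X}(t)=\mathbb{E}\big[\,|\mathcal{A}(X)_t\setminus K|/t\,\big]$, expectation over the internal randomness of $\mathcal{A}$. Feasible profile. For $D:\mathbb{N}\to\mathbb{N}$ let $D^{-1}(t)=\min\{n\in\mathbb{N}:D(n)\ge t\}$. $(D,H)$ is a feasible profile if $D:\mathbb{N}\to\mathbb{N}$ is monotone non-decreasing, discrete convex (the increments $D(n+1)-D(n)$ are non-decreasing) and super-linear ($D(n)/n\to\infty$), and $H:\mathbb{N}\to\mathbb{R}_{\ge0}$ is monotone non-increasing with $H(t)\to0$ and $H(t)=\omega(D^{-1}(t)/t)$. Density. For sequences $S=(s_1,s_2,\dots)$, $R=(r_1,r_2,\dots)$, put $S_n=\{s_1,\dots,s_n\}$ and $\mu_i(S,R,D)=\frac1i\sum_{j=1}^i \mathbf{1}\{r_j\in S_{D(j)}\}$. "$\mu_{low}(\mathcal{A},D)\ge\rho$ almost surely" means: for every countable collection $\mathcal{L}$, every $K\in\mathcal{L}$ and every admissible $X$ for $K$, with probability one over the internal randomness, $\liminf_{i\to\infty}\mu_i(\mathcal{A}(X),K,D)\ge\rho$.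 Black box. $\mathcal{B}_{\mathrm{KW}}$ is a deterministic eventually consistent generator of Kleinberg and Wei which, for every $\alpha\in[0,1]$, satisfies under $\mathfrak{D}_{\mathrm{part},\alpha}$ the guarantee (without deadlines) $\liminf_{i\to\infty}|\mathcal{B}_{\mathrm{KW}}(X)\cap K_i|/i\ge\alpha/2$ for all $\mathcal{L}$, $K\in\mathcal{L}$ and $X\in\mathfrak{D}_{\mathrm{part},\alpha}(K)$. The notation $\mathcal{A}_{\mathcal{B}}$ indicates that $\mathcal{A}$ is built from $\mathcal{B}$ using only black-box calls to $\mathcal{B}$.
   Formalization: A threshold for t uniform over all K and X is impossible (X may repeat one element common to otherwise disjoint languages); instead, for each T, the suprema range over the K and X on which the black box is consistent from time T on, and "sufficiently large" may depend on T. *)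

theory Defs
  imports "HOL-Probability.Probability" "HOL-Library.Landau_Symbols" "HOL-Library.Infinite_Set"
begin

text \<open>
  The universe is a type \<open>'u\<close> enumerated by a bijection \<open>u :: nat \<Rightarrow> 'u\<close>.  Infinite sequences are
  functions on \<^typ>\<open>nat\<close> indexed from 0, so the \<open>t\<close>-th term \<open>x\<^sub>t\<close> (\<open>t \<ge> 1\<close>) is \<open>X (t - 1)\<close>;
  the arguments of deadlines, densities and hallucination rates are counted from 1.
\<close>

definition listing :: "(nat \<Rightarrow> 'u) \<Rightarrow> 'u set \<Rightarrow> nat \<Rightarrow> 'u" where
  "listing u K j = u (enumerate {n. u n \<in> K} j)"

definition first_n :: "(nat \<Rightarrow> 'u) \<Rightarrow> nat \<Rightarrow> 'u set" where
  "first_n S n = S ` {..<n}"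

text \<open>A collection with finitely many members is an enumeration with repetitions.\<close>

definition collection :: "(nat \<Rightarrow> 'u set) \<Rightarrow> bool" where
  "collection L \<longleftrightarrow> (\<forall>i. infinite (L i))"

definition set_density :: "(nat \<Rightarrow> 'u) \<Rightarrow> 'u set \<Rightarrow> 'u set \<Rightarrow> ereal" where
  "set_density u S K =
     liminf (\<lambda>i. ereal (real (card (S \<inter> first_n (listing u K) i)) / real i))"

definition part_enum :: "(nat \<Rightarrow> 'u) \<Rightarrow> real \<Rightarrow> 'u set \<Rightarrow> (nat \<Rightarrow> 'u) set" where
  "part_enum u \<alpha> K =
     {X. range X \<subseteq> K \<and> infinite (range X) \<and> set_density u (range X) K \<ge> ereal \<alpha>}"

text \<open>
  For a fixed collection (and fixed internal randomness) the maps \<open>U\<^sup>t \<rightarrow> U\<close>, \<open>t \<ge> 1\<close>, are a single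
  function on lists; its value on the empty list is irrelevant.
\<close>

definition outputs :: "('u list \<Rightarrow> 'u) \<Rightarrow> (nat \<Rightarrow> 'u) \<Rightarrow> nat \<Rightarrow> 'u" where
  "outputs G X n = G (map X [0..<Suc n])"

definition generator ::
  "('u set \<Rightarrow> (nat \<Rightarrow> 'u) set) \<Rightarrow> (nat \<Rightarrow> 'u set) \<Rightarrow> ('u list \<Rightarrow> 'u) \<Rightarrow> bool" where
  "generator \<DD> L G \<longleftrightarrow>
     (\<forall>K\<in>range L. \<forall>X\<in>\<DD> K. \<forall>n.
        outputs G X n \<notin> outputs G X ` {..<n} \<and> outputs G X n \<notin> X ` {..n})"

definition consistent_from ::
  "('u list \<Rightarrow> 'u) \<Rightarrow> (nat \<Rightarrow> 'u) \<Rightarrow> 'u set \<Rightarrow> nat \<Rightarrow> bool" where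
  "consistent_from G X K T \<longleftrightarrow> (\<forall>n\<ge>T. outputs G X n \<in> K)"

definition eventually_consistent ::
  "('u set \<Rightarrow> (nat \<Rightarrow> 'u) set) \<Rightarrow> (nat \<Rightarrow> 'u set) \<Rightarrow> ('u list \<Rightarrow> 'u) \<Rightarrow> bool" where
  "eventually_consistent \<DD> L G \<longleftrightarrow>
     (\<forall>K\<in>range L. \<forall>X\<in>\<DD> K. \<exists>T. consistent_from G X K T)"

text \<open>
  The Kleinberg--Wei black box: \<open>B L\<close> is the deterministic generator for the collection \<open>L\<close>.
\<close>

definition kleinberg_wei ::
  "(nat \<Rightarrow> 'u) \<Rightarrow> ((nat \<Rightarrow> 'u set) \<Rightarrow> 'u list \<Rightarrow> 'u) \<Rightarrow> bool" where
  "kleinberg_wei u B \<longleftrightarrow>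
     (\<forall>L. collection L \<longrightarrow> (\<forall>\<beta>\<in>{0..1}.
        generator (part_enum u \<beta>) L (B L) \<and>
        eventually_consistent (part_enum u \<beta>) L (B L) \<and>
        (\<forall>K\<in>range L. \<forall>X\<in>part_enum u \<beta> K.
           set_density u (range (outputs (B L) X)) K \<ge> ereal (\<beta> / 2))))"

text \<open>
  A randomized generator draws its internal randomness \<open>\<omega>\<close> once from a probability space \<open>M\<close>
  and then runs the deterministic generator \<open>G \<omega>\<close>.
\<close>

definition randomized_generator ::
  "('u set \<Rightarrow> (nat \<Rightarrow> 'u) set) \<Rightarrow> (nat \<Rightarrow> 'u set) \<Rightarrow> 'w measure \<Rightarrow> ('w \<Rightarrow> 'u list \<Rightarrow> 'u) \<Rightarrow> bool" where
  "randomized_generator \<DD> L M G \<longleftrightarrow>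
     prob_space M \<and>
     (\<forall>xs. (\<lambda>\<omega>. G \<omega> xs) \<in> measurable M (count_space UNIV)) \<and>
     (\<forall>\<omega>\<in>space M. generator \<DD> L (G \<omega>))"

text \<open>
  \<open>F b\<close> is a generator with oracle \<open>b\<close>.  Access to \<open>b\<close> is by black-box calls only: every output is
  determined by the answers to finitely many (possibly adaptive) calls, so it is the same for any
  oracle giving these answers.
\<close>

definition black_box :: "(('u list \<Rightarrow> 'u) \<Rightarrow> 'u list \<Rightarrow> 'u) \<Rightarrow> bool" where
  "black_box F \<longleftrightarrow>
     (\<forall>b xs. \<exists>Q. finite Q \<and> (\<forall>b'. (\<forall>q\<in>Q. b' q = b q) \<longrightarrow> F b' xs = F b xs))"

definition hallucination_rate ::
  "'w measure \<Rightarrow> ('w \<Rightarrow> 'u list \<Rightarrow> 'u) \<Rightarrow> 'u set \<Rightarrow> (nat \<Rightarrow> 'u) \<Rightarrow> nat \<Rightarrow> real" where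
  "hallucination_rate M G K X t =
     (\<integral>\<omega>. real (card (first_n (outputs (G \<omega>) X) t - K)) / real t \<partial>M)"

definition deadline_density :: "nat \<Rightarrow> (nat \<Rightarrow> 'u) \<Rightarrow> (nat \<Rightarrow> 'u) \<Rightarrow> (nat \<Rightarrow> nat) \<Rightarrow> real" where
  "deadline_density i S R D =
     (\<Sum>j=1..i. of_bool (R (j - 1) \<in> first_n S (D j))) / real i"

text \<open>
  Deadlines and budgets are constrained at positive arguments only, and \<open>inv_deadline\<close> minimises
  over positive \<open>n\<close>.  Imposing the conditions at 0 as well would only strengthen the assumption:
  an unbounded \<open>D\<close> has \<open>D 0 < t\<close> for all large \<open>t\<close>, so allowing \<open>n = 0\<close> in the minimum changes
  only finitely many values.
\<close>

definition inv_deadline :: "(nat \<Rightarrow> nat) \<Rightarrow> nat \<Rightarrow> nat" where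
  "inv_deadline D t = (LEAST n. n \<ge> 1 \<and> D n \<ge> t)"

definition feasible_profile :: "(nat \<Rightarrow> nat) \<Rightarrow> (nat \<Rightarrow> real) \<Rightarrow> bool" where
  "feasible_profile D H \<longleftrightarrow>
     mono_on {1..} D \<and>
     (\<forall>n\<ge>1. int (D (n + 1)) - int (D n) \<le> int (D (n + 2)) - int (D (n + 1))) \<and>
     filterlim (\<lambda>n. real (D n) / real n) at_top sequentially \<and>
     (\<forall>t\<ge>1. H t \<ge> 0) \<and>
     antimono_on {1..} H \<and>
     H \<longlonglongrightarrow> 0 \<and>
     H \<in> \<omega>(\<lambda>t. real (inv_deadline D t) / real t)"

lemma image_indices:
  assumes "bij u"
  shows "u ` {n. u n \<in> K} = K"
  using bij_is_surj[OF assms] by (force simp: image_iff surj_def)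

lemma infinite_indices:
  assumes "bij u" "infinite K"
  shows "infinite {n. u n \<in> K}"
  using assms image_indices finite_imageI by metis

lemma listing_range:
  assumes "bij u" "infinite K"
  shows "range (listing u K) = K"
proof -
  have "range (listing u K) = u ` range (enumerate {n. u n \<in> K})"
    by (auto simp: listing_def)
  then show ?thesis
    using range_enumerate[OF infinite_indices[OF assms]] image_indices[OF assms(1)] by simp
qed

lemma card_outputs:
  assumes "generator \<DD> L G" "K \<in> range L" "X \<in> \<DD> K"
  shows "card (first_n (outputs G X) t - K') = (\<Sum>s<t. of_bool (outputs G X s \<notin> K'))"
proof (induction t)
  case 0
  show ?case by (simp add: first_n_def)
next
  case (Suc t)
  have "outputs G X t \<notin> first_n (outputs G X) t"
    using assms unfolding generator_def first_n_def by blast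
  moreover have "first_n (outputs G X) (Suc t) - K' =
      (if outputs G X t \<in> K' then {} else {outputs G X t}) \<union> (first_n (outputs G X) t - K')"
    by (auto simp: first_n_def lessThan_Suc)
  moreover have "finite (first_n (outputs G X) t - K')"
    by (simp add: first_n_def)
  ultimately show ?case using Suc.IH by simp
qed

lemma part_enum_full:
  assumes "bij u" "infinite K" "\<alpha> \<le> 1" "range X = K"
  shows "X \<in> part_enum u \<alpha> K"
proof -
  have inj: "inj (listing u K)"
    using bij_is_inj[OF assms(1)] strict_mono_enumerate[OF infinite_indices[OF assms(1,2)]]
    by (auto simp: listing_def inj_def dest: strict_mono_eq)
  have *: "card (K \<inter> first_n (listing u K) i) = i" for i
  proof -
    have "K \<inter> first_n (listing u K) i = listing u K ` {..<i}"
      using listing_range[OF assms(1,2)] by (auto simp: first_n_def)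
    then show ?thesis using inj by (simp add: card_image inj_on_subset)
  qed
  have "\<forall>\<^sub>F i in sequentially.
      ereal \<alpha> \<le> ereal (real (card (K \<inter> first_n (listing u K) i)) / real i)"
    using eventually_gt_at_top[of "0 :: nat"] by eventually_elim (use assms(3) * in simp)
  then have "ereal \<alpha> \<le> liminf (\<lambda>i. ereal (real (card (K \<inter> first_n (listing u K) i)) / real i))"
    by (rule Liminf_bounded)
  then show ?thesis using assms by (auto simp: part_enum_def set_density_def)
qed

text \<open>
  Since observations may be repeated, an adversary can withhold all information up to any given
  time.  Hence no bound below 1 on the hallucination rate can hold from a time on that is uniform
  over all languages and admissible sequences of a collection, as the following lemma shows.
  In a bound by a vanishing budget, "sufficiently large" therefore has to be relative to how long
  the black box takes to become consistent on the given input.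
\<close>

lemma no_uniform_hallucination_bound:
  fixes u :: "nat \<Rightarrow> 'u" and \<alpha> :: real
  assumes u: "bij u" and \<alpha>: "\<alpha> \<le> 1"
  obtains L :: "nat \<Rightarrow> 'u set" where "collection L"
    and "\<And>(M :: 'w measure) G t. randomized_generator (part_enum u \<alpha>) L M G \<Longrightarrow> t \<ge> 1 \<Longrightarrow>
      (SUP K\<in>range L. SUP X\<in>part_enum u \<alpha> K. ereal (hallucination_rate M G K X t)) \<ge> 1"
proof -
  define L where "L i = insert (u 0) (u ` {Suc (prod_encode (i, m)) | m. True})" for i
  have inju: "u a = u b \<longleftrightarrow> a = b" for a b
    using bij_is_inj[OF u] by (auto dest: injD)
  have inf: "infinite (L i)" for i
  proof -
    have "inj (\<lambda>m. u (Suc (prod_encode (i, m))))"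
      by (auto simp: inj_def inju)
    then have "infinite (range (\<lambda>m. u (Suc (prod_encode (i, m)))))"
      using finite_imageD by blast
    moreover have "range (\<lambda>m. u (Suc (prod_encode (i, m)))) \<subseteq> L i"
      by (auto simp: L_def)
    ultimately show ?thesis using finite_subset by blast
  qed
  have disj: "i = j" if "x \<in> L i" "x \<in> L j" "x \<noteq> u 0" for x i j
    using that by (auto simp: L_def inju)
  have "1 \<le> (SUP K\<in>range L. SUP X\<in>part_enum u \<alpha> K. ereal (hallucination_rate M G K X t))"
    (is "1 \<le> ?S")
    if gen: "randomized_generator (part_enum u \<alpha>) L M G" and t: "t \<ge> 1"
    for M :: "'w measure" and G t
  proof -
    interpret prob_space M using gen by (simp add: randomized_generator_def)
    define X where "X i s = (if s < t then u 0 else listing u (L i) (s - t))" for i s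
    have "range (X i) = L i" for i
    proof -
      have "range (X i) \<subseteq> L i"
        using listing_range[OF u inf[of i]] by (auto simp: X_def L_def)
      moreover have "L i \<subseteq> range (X i)"
      proof
        fix x assume "x \<in> L i"
        then obtain n where "x = listing u (L i) n"
          using listing_range[OF u inf[of i]] by auto
        then have "x = X i (n + t)" by (simp add: X_def)
        then show "x \<in> range (X i)" by blast
      qed
      ultimately show ?thesis by blast
    qed
    then have X: "X i \<in> part_enum u \<alpha> (L i)" for i
      using part_enum_full[OF u inf \<alpha>] by blast
    have genw: "generator (part_enum u \<alpha>) L (G \<omega>)" if "\<omega> \<in> space M" for \<omega>
      using gen that by (simp add: randomized_generator_def)
    define c where "c \<omega> s = G \<omega> (replicate (Suc s) (u 0))" for \<omega> s
    have out: "outputs (G \<omega>) (X i) s = c \<omega> s" if "s < t" for \<omega> i s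
    proof -
      have "map (X i) [0..<Suc s] = replicate (Suc s) (u 0)"
        using that by (intro nth_equalityI) (auto simp: X_def simp del: upt_Suc replicate_Suc)
      then show ?thesis by (simp add: outputs_def c_def del: upt_Suc)
    qed
    have c0: "c \<omega> s \<noteq> u 0" if "\<omega> \<in> space M" "s < t" for \<omega> s
    proof -
      have "outputs (G \<omega>) (X 0) s \<notin> X 0 ` {..s}"
        using genw[OF that(1)] X[of 0] by (auto simp: generator_def)
      then show ?thesis using out[OF that(2)] that(2) by (force simp: X_def)
    qed
    have meas: "(\<lambda>\<omega>. c \<omega> s) \<in> measurable M (count_space UNIV)" for s
      using gen by (simp add: randomized_generator_def c_def)
    define E where "E i s = {\<omega> \<in> space M. c \<omega> s \<in> L i}" for i s
    have E: "E i s \<in> sets M" for i s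
      using measurable_sets[OF meas[of s], of "L i"] by (simp add: E_def vimage_def Int_def conj_commute)
    have small: "(\<Sum>i<N. prob (E i s)) \<le> 1" if "s < t" for N s
    proof -
      have "disjoint_family_on (\<lambda>i. E i s) {..<N}"
        using disj c0 that by (fastforce simp: disjoint_family_on_def E_def)
      then have "(\<Sum>i<N. prob (E i s)) = prob (\<Union>i<N. E i s)"
        using E by (intro finite_measure_finite_Union[symmetric]) auto
      then show ?thesis by simp
    qed
    have rate: "hallucination_rate M G (L i) (X i) t = (\<Sum>s<t. 1 - prob (E i s)) / real t" for i
    proof -
      have "hallucination_rate M G (L i) (X i) t =
          (\<integral>\<omega>. (\<Sum>s<t. indicator (space M - E i s) \<omega>) / real t \<partial>M)"
        unfolding hallucination_rate_def
      proof (rule Bochner_Integration.integral_cong[OF refl])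
        fix \<omega> assume w: "\<omega> \<in> space M"
        show "real (card (first_n (outputs (G \<omega>) (X i)) t - L i)) / real t =
            (\<Sum>s<t. indicator (space M - E i s) \<omega>) / real t"
          using w by (subst card_outputs[OF genw[OF w] _ X[of i]])
            (auto simp: out E_def indicator_def intro!: sum.cong arg_cong[where f = "\<lambda>x. x / real t"])
      qed
      also have "\<dots> = (\<Sum>s<t. prob (space M - E i s)) / real t"
        using E by (simp add: less_top[symmetric])
      finally show ?thesis using E by (simp add: prob_compl)
    qed
    have up: "ereal (hallucination_rate M G (L i) (X i) t) \<le> ?S" for i
      by (rule SUP_upper2[of "L i"]) (auto intro: SUP_upper2[OF X])
    have ge: "ereal (1 - 1 / real N) \<le> ?S" if N: "N \<ge> 1" for N
    proof (rule ccontr)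
      assume "\<not> ereal (1 - 1 / real N) \<le> ?S"
      then have "ereal (hallucination_rate M G (L i) (X i) t) < ereal (1 - 1 / real N)" for i
        using up[of i] by (meson not_le order_le_less_trans)
      then have "hallucination_rate M G (L i) (X i) t < 1 - 1 / real N" for i
        by simp
      then have "(\<Sum>i<N. hallucination_rate M G (L i) (X i) t) < (\<Sum>i<N. 1 - 1 / real N)"
        using N by (intro sum_strict_mono) (auto simp: lessThan_empty_iff)
      also have "\<dots> = real N - 1" using N by (simp add: field_simps)
      finally have lt: "(\<Sum>i<N. hallucination_rate M G (L i) (X i) t) < real N - 1" .
      have "(\<Sum>i<N. hallucination_rate M G (L i) (X i) t) =
          (\<Sum>s<t. real N - (\<Sum>i<N. prob (E i s))) / real t"
        unfolding rate by (subst sum_divide_distrib[symmetric], subst sum.swap)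
          (simp add: sum_subtractf)
      moreover have "(\<Sum>s<t. real N - 1) \<le> (\<Sum>s<t. real N - (\<Sum>i<N. prob (E i s)))"
        using small by (intro sum_mono) simp
      ultimately have "real t * (real N - 1) \<le> real t * (\<Sum>i<N. hallucination_rate M G (L i) (X i) t)"
        using t by simp
      then have "real N - 1 \<le> (\<Sum>i<N. hallucination_rate M G (L i) (X i) t)"
        using t by (subst (asm) mult_le_cancel_left_pos) auto
      then show False using lt by linarith
    qed
    have "(\<lambda>n. 1 - 1 / real n) \<longlonglongrightarrow> 1 - 0"
      by (intro tendsto_intros lim_1_over_n)
    then have "(\<lambda>n. ereal (1 - 1 / real n)) \<longlonglongrightarrow> ereal 1" by simp
    then have "ereal 1 \<le> ?S"
      by (rule LIMSEQ_le_const2) (use ge in blast)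
    then show ?thesis by (simp add: one_ereal_def)
  qed
  then show ?thesis using that[of L] inf by (auto simp: collection_def)
qed

end

theory Submission
  imports Defs
begin

text \<open>
  Time is cut into blocks whose lengths tend to infinity, and each block contains one exploration
  step at a uniformly random position.  All other steps copy the black box.  The exploration steps
  take turns between the languages of the collection, each language receiving a fixed positive
  fraction of them, and output the first element of the chosen language that is still available.

  The budget \<open>t H(t) = \<omega>(D\<^sup>-\<^sup>1(t))\<close> leaves room for block starts \<open>s\<close> with \<open>s (C j) \<le> D j\<close> for every \<open>C\<close>
  and all large \<open>j\<close>, so the explorations devoted to \<open>K\<close> reach \<open>k\<^sub>j\<close> before its deadline unless it has
  been observed.  Hence an element that the black box outputs at some step \<open>\<tau>\<close> meets its deadline:
  by copying if \<open>\<tau>\<close> precedes the deadline, and by exploration otherwise, because it is unobserved up to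
  \<open>\<tau>\<close>.  The only exceptions are elements whose \<open>\<tau>\<close> happens to be an exploration step; since the input
  does not depend on the randomness, Hoeffding's inequality makes them a set of density 0.
\<close>

subsection \<open>Exploration schedules\<close>

text \<open>Block \<open>b\<close> runs from \<open>s b\<close> to just before
  \<open>s (Suc b)\<close> and holds one exploration. Growing gaps make explorations sparse, and the
  third clause makes them early enough for the deadlines. In the last clause, if \<open>b\<close> is
  the last block begun before \<open>t\<close>, then \<open>b + 1\<close> bounds the explorations so
  far and \<open>T\<close> is the allowance for early errors.\<close>

definition exploration_schedule :: "(nat \<Rightarrow> nat) \<Rightarrow> (nat \<Rightarrow> real) \<Rightarrow> (nat \<Rightarrow> nat) \<Rightarrow> bool" where
  "exploration_schedule D H s \<longleftrightarrow>
     strict_mono s \<and>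
     filterlim (\<lambda>b. s (Suc b) - s b) at_top sequentially \<and>
     (\<forall>C. \<forall>\<^sub>F j in sequentially. s (C * j) \<le> D j) \<and>
     (\<forall>T. \<forall>\<^sub>F b in sequentially. \<forall>t>s b. real (b + T + 1) \<le> real t * H t)"

lemma superlinear_ge:
  assumes "filterlim (\<lambda>n. real (D n) / real n) at_top sequentially"
  shows "\<forall>\<^sub>F n in sequentially. C * n \<le> D n"
proof -
  have "\<forall>\<^sub>F n in sequentially. real C \<le> real (D n) / real n"
    using assms by (simp add: filterlim_at_top)
  then show ?thesis
    using eventually_gt_at_top[of "0 :: nat"]
  proof eventually_elim
    case (elim n)
    then have "real (C * n) \<le> real (D n)" by (simp add: field_simps)
    then show ?case by linarith
  qed
qed

text \<open>Some positive \<open>n\<close> reaches \<open>t\<close>, so the minimum defining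
  \<open>inv_deadline\<close> is attained. By monotonicity it cannot be attained at or before
  \<open>j\<close>.\<close>

lemma inv_deadline_gt:
  assumes "mono_on {1..} D" "\<exists>n\<ge>1. t \<le> D n" "D j < t" "1 \<le> j"
  shows "j < inv_deadline D t"
proof -
  obtain n where "n \<ge> 1 \<and> t \<le> D n" using assms(2) by blast
  then have "1 \<le> inv_deadline D t \<and> t \<le> D (inv_deadline D t)"
    unfolding inv_deadline_def by (rule LeastI)
  then show ?thesis
    using mono_onD[OF assms(1), of "inv_deadline D t" j] assms(3,4)
    by (metis atLeast_iff le_trans not_le)
qed

text \<open>A diagonal choice: \<open>d b\<close> is the largest \<open>k \<le> b\<close> such that
  \<open>D j\<close> is at least \<open>4 * k\<^sup>2 * j\<close> at every \<open>j\<close> with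
  \<open>k * j \<ge> b\<close>. Enlarging \<open>b\<close> weakens this demand, so \<open>d\<close>
  is monotone; super-linearity makes it unbounded.\<close>

lemma slow_growth:
  assumes "filterlim (\<lambda>n. real (D n) / real n) at_top sequentially"
  obtains d :: "nat \<Rightarrow> nat" where "mono d" "filterlim d at_top sequentially"
    "\<And>C. \<forall>\<^sub>F j in sequentially. 2 * (C * j * Suc (d (C * j))) \<le> D j"
proof -
  define P where "P k b \<longleftrightarrow> (\<forall>j. b \<le> k * j \<longrightarrow> 4 * k\<^sup>2 * j \<le> D j)" for k b
  define d where "d b = (GREATEST k. k \<le> b \<and> P k b)" for b
  \<comment> \<open>The factor 0 always qualifies and all candidates are bounded by
    \<open>b\<close>, so \<open>GREATEST\<close> is attained.\<close>
  have P0: "0 \<le> b \<and> P 0 b" for b by (simp add: P_def)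
  have d: "d b \<le> b \<and> P (d b) b" for b
    unfolding d_def using P0 by (rule GreatestI_nat[where b = b]) blast
  have d_ge: "k \<le> d b" if "k \<le> b" "P k b" for k b
    unfolding d_def using that by (intro Greatest_le_nat[where b = b]) auto
  have P_mono: "P k b'" if "P k b" "b \<le> b'" for k b b'
    using that by (auto simp: P_def)
  have "mono d"
    using d d_ge P_mono by (intro monoI) (meson le_trans)
  have ev: "\<forall>\<^sub>F b in sequentially. k \<le> d b" for k
  proof -
    obtain N where N: "\<And>j. N \<le> j \<Longrightarrow> 4 * k\<^sup>2 * j \<le> D j"
      using superlinear_ge[OF assms, of "4 * k\<^sup>2"] by (auto simp: eventually_sequentially)
    have "k \<le> d b" if "k * N + k + 1 \<le> b" for b
    proof (rule d_ge)
      show "P k b"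
        unfolding P_def
      proof (intro allI impI)
        fix j assume "b \<le> k * j"
        with that have "k * N < k * j" by linarith
        then show "4 * k\<^sup>2 * j \<le> D j" using N by simp
      qed
    qed (use that in simp)
    then show ?thesis by (auto simp: eventually_sequentially)
  qed
  then have lim: "filterlim d at_top sequentially" by (simp add: filterlim_at_top)
  have "\<forall>\<^sub>F j in sequentially. 2 * (C * j * Suc (d (C * j))) \<le> D j" for C
  proof (cases "C = 0")
    case True
    then show ?thesis by simp
  next
    case False
    then have "filterlim (\<lambda>j. C * j) at_top sequentially"
      by (intro filterlim_subseq) (auto simp: strict_mono_def)
    then have "\<forall>\<^sub>F j in sequentially. C + 1 \<le> d (C * j)"
      using ev[of "C + 1"] by (rule eventually_compose_filterlim[rotated])
    then show ?thesis
    proof eventually_elim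
      case (elim j)
      let ?d = "d (C * j)"
      \<comment> \<open>The defining property of \<open>d\<close> is applied at
        \<open>b = C * j\<close>. Of its factor 4, one 2 pays for \<open>Suc ?d \<le> 2 * ?d\<close>
        and the other is the 2 of the claim.\<close>
      have "C * j \<le> ?d * j" using elim by simp
      then have "4 * ?d\<^sup>2 * j \<le> D j" using d[of "C * j"] by (auto simp: P_def)
      moreover have "C * j * Suc ?d \<le> (?d * j) * (2 * ?d)"
        using elim by (intro mult_mono) auto
      ultimately show ?case by (simp add: power2_eq_square mult_ac)
    qed
  qed
  then show ?thesis using that \<open>mono d\<close> lim by blast
qed

text \<open>For large \<open>t\<close> beyond \<open>D j\<close> the growth condition on
  \<open>H\<close> gives \<open>t * H t \<ge> 2 * C * inv_deadline D t\<close>, and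
  \<open>inv_deadline D t\<close> exceeds \<open>j\<close>. Times down to half of \<open>D j\<close>
  are reached by comparing \<open>t\<close> with \<open>t' = max t (D j + 1)\<close>, which is at
  most \<open>2 * t\<close>: \<open>H\<close> is antitone, so only a factor 2 is lost.\<close>

lemma budget_slack:
  assumes "feasible_profile D H"
  shows "\<forall>\<^sub>F j in sequentially. \<forall>t. D j < 2 * t \<longrightarrow> real C * real j \<le> real t * H t"
proof -
  have mono: "mono_on {1..} D" and sup: "filterlim (\<lambda>n. real (D n) / real n) at_top sequentially"
    and H0: "\<And>t. t \<ge> 1 \<Longrightarrow> H t \<ge> 0" and anti: "antimono_on {1..} H"
    and om: "H \<in> \<omega>(\<lambda>t. real (inv_deadline D t) / real t)"
    using assms by (auto simp: feasible_profile_def)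
  obtain n0 where n0: "\<And>n. n0 \<le> n \<Longrightarrow> 1 * n \<le> D n"
    using superlinear_ge[OF sup, of 1] unfolding eventually_sequentially by blast
  have unb: "\<exists>n\<ge>1. t \<le> D n" for t
    using n0[of "n0 + t + 1"] by (intro exI[of _ "n0 + t + 1"]) simp
  \<comment> \<open>The constant must be positive although \<open>C\<close> may be 0; the extra 1 is
    dropped right away.\<close>
  have "2 * real C + 1 > 0" by simp
  from landau_omega.smallD[OF om this]
  have "\<forall>\<^sub>F t in sequentially. 2 * real C * norm (real (inv_deadline D t) / real t) \<le> norm (H t)"
  proof eventually_elim
    case (elim t)
    then show ?case
      by (intro order_trans[OF mult_right_mono[of "2 * real C" "2 * real C + 1"]]) (auto simp: mult_ac)
  qed
  then obtain N where N: "\<And>t. N \<le> t \<Longrightarrow>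
      2 * real C * norm (real (inv_deadline D t) / real t) \<le> norm (H t)"
    by (auto simp: eventually_sequentially)
  have key: "2 * real C * real j \<le> real t * H t" if "t \<ge> N" "t \<ge> 1" "D j < t" "1 \<le> j" for t j
  proof -
    have "2 * real C * real j \<le> 2 * real C * real (inv_deadline D t)"
      using inv_deadline_gt[OF mono unb that(3,4)] by (intro mult_left_mono) auto
    also have "\<dots> \<le> real t * H t"
      using N[OF that(1)] H0[OF that(2)] that(2) by (simp add: field_simps)
    finally show ?thesis .
  qed
  show ?thesis
    using superlinear_ge[OF sup, of 1] eventually_ge_at_top[of "N + 1"]
  proof eventually_elim
    case (elim j)
    show ?case
    proof (intro allI impI)
      fix t assume t: "D j < 2 * t"
      then have t1: "t \<ge> 1" by simp
      define t' where "t' = max t (D j + 1)"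
      have "2 * real C * real j \<le> real t' * H t'"
        using elim by (intro key) (auto simp: t'_def)
      also have "\<dots> \<le> real t' * H t"
        using monotone_onD[OF anti, of t t'] t1 by (intro mult_left_mono) (auto simp: t'_def)
      also have "\<dots> \<le> real (2 * t) * H t"
        using t H0[OF t1] by (intro mult_right_mono) (auto simp: t'_def)
      finally show "real C * real j \<le> real t * H t" by simp
    qed
  qed
qed

text \<open>In \<open>s b = f b + b * Suc (d b)\<close> the first summand is a time after which the
  budget covers \<open>2 * b + 1\<close> errors, and the second makes the blocks grow. At
  \<open>b = C * j\<close> each summand takes at most half of \<open>D j\<close>.\<close>

lemma exploration_schedule_exists:
  assumes "feasible_profile D H"
  obtains s where "exploration_schedule D H s"
proof -
  have sup: "filterlim (\<lambda>n. real (D n) / real n) at_top sequentially"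
    using assms by (auto simp: feasible_profile_def)
  obtain d where d: "mono d" "filterlim d at_top sequentially"
    "\<And>C. \<forall>\<^sub>F j in sequentially. 2 * (C * j * Suc (d (C * j))) \<le> D j"
    using slow_growth[OF sup] by blast
  define Q where "Q b r \<longleftrightarrow> (\<forall>t>r. real (2 * b + 1) \<le> real t * H t)" for b r
  define f where "f b = (LEAST r. Q b r)" for b
  have "\<exists>r. Q b r" for b
  proof -
    obtain j where j: "j \<ge> 1" "\<And>t. D j < 2 * t \<Longrightarrow> real (2 * b + 1) * real j \<le> real t * H t"
      using eventually_conj[OF budget_slack[OF assms, of "2 * b + 1"] eventually_ge_at_top[of "1 :: nat"]]
      unfolding eventually_sequentially by blast
    have "Q b (D j)"
      unfolding Q_def
    proof (intro allI impI)
      fix t assume "D j < t"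
      have "real (2 * b + 1) * 1 \<le> real (2 * b + 1) * real j"
        using j(1) by (intro mult_left_mono) auto
      also have "\<dots> \<le> real t * H t" using j(2)[of t] \<open>D j < t\<close> by simp
      finally show "real (2 * b + 1) \<le> real t * H t" by simp
    qed
    then show ?thesis by blast
  qed
  then have f: "Q b (f b)" for b unfolding f_def by (metis LeastI)
  have f_le: "f b \<le> r" if "Q b r" for b r
    unfolding f_def using that by (rule Least_le)
  have "mono f"
  proof (rule monoI, rule f_le)
    fix b b' :: nat assume "b \<le> b'"
    then show "Q b (f b')" using f[of b'] by (fastforce simp: Q_def)
  qed
  define s where "s b = f b + b * Suc (d b)" for b
  \<comment> \<open>This gives both strict monotonicity and, since \<open>d\<close> diverges, the
    divergence of the block lengths.\<close>
  have gap: "s b + Suc (d (Suc b)) \<le> s (Suc b)" for b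
  proof -
    have "b * Suc (d b) \<le> b * Suc (d (Suc b))"
      using monoD[OF d(1), of b "Suc b"] by (intro mult_le_mono) auto
    moreover have "s (Suc b) = f (Suc b) + b * Suc (d (Suc b)) + Suc (d (Suc b))"
      by (simp add: s_def)
    moreover have "s b = f b + b * Suc (d b)" by (simp add: s_def)
    moreover have "f b \<le> f (Suc b)" using monoD[OF \<open>mono f\<close>, of b "Suc b"] by simp
    ultimately show ?thesis by linarith
  qed
  have "strict_mono s"
    unfolding strict_mono_Suc_iff
  proof
    show "s b < s (Suc b)" for b using gap[of b] by linarith
  qed
  moreover have "filterlim (\<lambda>b. s (Suc b) - s b) at_top sequentially"
  proof (rule filterlim_at_top_mono)
    show "filterlim (\<lambda>b. d (Suc b)) at_top sequentially"
      using d(2) filterlim_Suc by (rule filterlim_compose)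
    show "\<forall>\<^sub>F b in sequentially. d (Suc b) \<le> s (Suc b) - s b"
    proof (intro always_eventually allI)
      show "d (Suc b) \<le> s (Suc b) - s b" for b using gap[of b] by linarith
    qed
  qed
  moreover have "\<forall>\<^sub>F j in sequentially. s (C * j) \<le> D j" for C
    using d(3)[of C] budget_slack[OF assms, of "2 * C + 1"] eventually_ge_at_top[of 1]
  proof eventually_elim
    case (elim j)
    \<comment> \<open>By minimality of \<open>f\<close> this bounds \<open>f (C * j)\<close> by half
      the deadline.\<close>
    have "Q (C * j) (D j div 2)"
      unfolding Q_def
    proof (intro allI impI)
      fix t assume "D j div 2 < t"
      then have "real (2 * C + 1) * real j \<le> real t * H t" using elim(2) by simp
      moreover have "real (2 * (C * j) + 1) \<le> real (2 * C + 1) * real j"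
        using elim(3) by (simp add: algebra_simps)
      ultimately show "real (2 * (C * j) + 1) \<le> real t * H t" by linarith
    qed
    then show ?case using f_le[of "C * j" "D j div 2"] elim(1) by (simp add: s_def)
  qed
  \<comment> \<open>Once \<open>b \<ge> T\<close>, the \<open>2 * b + 1\<close> errors provided for
    include \<open>b + T + 1\<close>.\<close>
  moreover have "\<forall>\<^sub>F b in sequentially. \<forall>t>s b. real (b + T + 1) \<le> real t * H t" for T
    using eventually_ge_at_top[of T]
  proof eventually_elim
    case (elim b)
    show ?case
    proof (intro allI impI)
      fix t assume "s b < t"
      then have "real (2 * b + 1) \<le> real t * H t" using f[of b] by (simp add: Q_def s_def)
      then show "real (b + T + 1) \<le> real t * H t" using elim by simp
    qed
  qed
  ultimately show ?thesis using that unfolding exploration_schedule_def by blast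
qed

subsection \<open>The greedy generator\<close>

text \<open>The rule \<open>c\<close> sees the history and the set of forbidden elements. A
  generator receives observations only, so its past outputs are recomputed from the proper nonempty
  prefixes of the history.\<close>

function greedy :: "('u list \<Rightarrow> 'u set \<Rightarrow> 'u) \<Rightarrow> 'u list \<Rightarrow> 'u" where
  "greedy c xs = c xs (set xs \<union> (\<lambda>k. greedy c (take k xs)) ` {1..<length xs})"
  by auto
termination
  by (relation "Wellfounded.measure (length \<circ> snd)") auto

declare greedy.simps [simp del]

lemma outputs_greedy:
  "outputs (greedy c) X n =
     c (map X [0..<Suc n]) (X ` {..n} \<union> outputs (greedy c) X ` {..<n})"
proof -
  have "(\<lambda>k. greedy c (take k (map X [0..<Suc n]))) ` {1..<Suc n} =
      (\<lambda>k. greedy c (map X [0..<k])) ` {1..<Suc n}"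
    by (rule image_cong) (simp_all add: take_map del: upt_Suc)
  moreover have "{1..<Suc n} = Suc ` {..<n}"
    by (simp add: lessThan_atLeast0 image_Suc_atLeastLessThan)
  moreover have "outputs (greedy c) X = (\<lambda>n. greedy c (map X [0..<Suc n]))"
    by (rule ext) (rule outputs_def)
  ultimately have "(\<lambda>k. greedy c (take k (map X [0..<Suc n]))) ` {1..<Suc n} = outputs (greedy c) X ` {..<n}"
    by (simp only: image_image)
  moreover have "set (map X [0..<Suc n]) = X ` {..n}"
    by (simp only: set_map set_upt atLeast0LessThan lessThan_Suc_atMost)
  ultimately show ?thesis
    unfolding outputs_def by (subst greedy.simps) (simp only: length_map length_upt diff_zero)
qed

lemma inj_if_fresh:
  fixes f :: "nat \<Rightarrow> 'a"
  assumes "\<And>n. f n \<notin> f ` {..<n}"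
  shows "inj f"
proof (rule injI)
  fix m n assume eq: "f m = f n"
  show "m = n"
  proof (cases m n rule: linorder_cases)
    case less
    then have "f m \<in> f ` {..<n}" by simp
    then show ?thesis using assms[of n] eq by simp
  next
    case greater
    then have "f n \<in> f ` {..<m}" by simp
    then show ?thesis using assms[of m] eq by simp
  qed
qed

lemma generator_greedy:
  assumes "\<And>xs F. finite F \<Longrightarrow> c xs F \<notin> F"
  shows "generator \<DD> L (greedy c)"
proof -
  have "outputs (greedy c) X n \<notin> X ` {..n} \<union> outputs (greedy c) X ` {..<n}" for X n
    by (subst outputs_greedy) (intro assms, simp)
  then show ?thesis by (auto simp: generator_def)
qed

definition first_fresh :: "(nat \<Rightarrow> 'u) \<Rightarrow> 'u set \<Rightarrow> 'u set \<Rightarrow> 'u" where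
  "first_fresh u K F = listing u K (LEAST j. listing u K j \<notin> F)"

lemma first_fresh_notin:
  assumes "bij u" "infinite K" "finite F"
  shows "first_fresh u K F \<notin> F"
proof -
  have "\<exists>j. listing u K j \<notin> F"
    using assms(3) finite_subset[of "range (listing u K)" F] listing_range[OF assms(1,2)] assms(2)
    by (metis image_subsetI)
  then show ?thesis unfolding first_fresh_def by (rule LeastI_ex)
qed

text \<open>For the counting argument: while an element stays available, the explorations of its
  language cannot move past it.\<close>

lemma first_fresh_le:
  assumes "listing u K j \<notin> F"
  shows "first_fresh u K F \<in> listing u K ` {..j}"
  using Least_le[of "\<lambda>j. listing u K j \<notin> F" j] assms by (auto simp: first_fresh_def)

text \<open>
  \<open>e k\<close> is the step of the \<open>k\<close>-th exploration.  It is spent on the language whose index is the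
  exponent of 2 in \<open>k + 1\<close>, so that every language receives a positive fraction of all explorations.
\<close>

definition mixed_choice ::
  "(nat \<Rightarrow> 'u) \<Rightarrow> (nat \<Rightarrow> nat) \<Rightarrow> (nat \<Rightarrow> 'u set) \<Rightarrow> ('u list \<Rightarrow> 'u) \<Rightarrow> 'u list \<Rightarrow> 'u set \<Rightarrow> 'u" where
  "mixed_choice u e L b xs F =
     (if \<exists>k<length xs. e k = length xs - 1
      then first_fresh u (L (multiplicity 2 (Suc (LEAST k. e k = length xs - 1)))) F
      else if b xs \<notin> F then b xs else first_fresh u UNIV F)"

lemma infinite_universe:
  assumes "bij (u :: nat \<Rightarrow> 'u)"
  shows "infinite (UNIV :: 'u set)"
  using assms bij_betw_finite infinite_UNIV_nat by blast

lemma mixed_choice_notin: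
  assumes "bij u" "collection L" "finite F"
  shows "mixed_choice u e L b xs F \<notin> F"
  using first_fresh_notin[OF assms(1) _ assms(3)] assms(2) infinite_universe[OF assms(1)]
  by (auto simp: mixed_choice_def collection_def)

text \<open>The recursion consults the oracle on prefixes of \<open>xs\<close> only, which provides
  the finite set of calls demanded by \<open>black_box\<close>.\<close>

lemma greedy_mixed_oracle_cong:
  assumes "\<And>k. k \<le> length xs \<Longrightarrow> b' (take k xs) = b (take k xs)"
  shows "greedy (mixed_choice u e L b') xs = greedy (mixed_choice u e L b) xs"
  using assms
proof (induction xs rule: length_induct)
  case (1 xs)
  have "greedy (mixed_choice u e L b') (take k xs) = greedy (mixed_choice u e L b) (take k xs)"
    if "k < length xs" for k
    using that 1 by (simp add: min_def)
  then have "(\<lambda>k. greedy (mixed_choice u e L b') (take k xs)) ` {1..<length xs} =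
      (\<lambda>k. greedy (mixed_choice u e L b) (take k xs)) ` {1..<length xs}"
    by (intro image_cong) auto
  moreover have "b' xs = b xs" using 1(2)[of "length xs"] by simp
  ultimately show ?case
    unfolding greedy.simps[of _ xs] by (simp only: mixed_choice_def)
qed

lemma black_box_greedy_mixed: "black_box (\<lambda>b. greedy (mixed_choice u e L b))"
  unfolding black_box_def
proof (intro allI)
  fix b :: "'a list \<Rightarrow> 'a" and xs
  show "\<exists>Q. finite Q \<and> (\<forall>b'. (\<forall>q\<in>Q. b' q = b q) \<longrightarrow>
      greedy (mixed_choice u e L b') xs = greedy (mixed_choice u e L b) xs)"
    by (rule exI[of _ "(\<lambda>k. take k xs) ` {..length xs}"]) (auto intro!: greedy_mixed_oracle_cong)
qed

text \<open>The search for \<open>k\<close> in \<open>mixed_choice\<close> is bounded by the length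
  of the history. Thus each output depends on finitely many exploration times, from which
  measurability follows.\<close>

lemma greedy_mixed_schedule_cong:
  assumes "\<And>k. k < length xs \<Longrightarrow> e' k = e k"
  shows "greedy (mixed_choice u e' L b) xs = greedy (mixed_choice u e L b) xs"
  using assms
proof (induction xs rule: length_induct)
  case (1 xs)
  have "greedy (mixed_choice u e' L b) (take k xs) = greedy (mixed_choice u e L b) (take k xs)"
    if "k < length xs" for k
    using that 1 by (simp add: min_def)
  then have "(\<lambda>k. greedy (mixed_choice u e' L b) (take k xs)) ` {1..<length xs} =
      (\<lambda>k. greedy (mixed_choice u e L b) (take k xs)) ` {1..<length xs}"
    by (intro image_cong) auto
  moreover have "mixed_choice u e' L b xs F = mixed_choice u e L b xs F" for F
  proof (cases "\<exists>k<length xs. e k = length xs - 1")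
    case True
    then obtain k where k: "k < length xs" "e k = length xs - 1" by blast
    \<comment> \<open>The least hit of \<open>e\<close> lies below \<open>length xs\<close>, where
      both schedules agree; a hit of \<open>e'\<close> at or beyond \<open>length xs\<close> is
      larger anyway.\<close>
    have "(LEAST k. e' k = length xs - 1) = (LEAST k. e k = length xs - 1)"
    proof (rule Least_equality)
      show "e' (LEAST k. e k = length xs - 1) = length xs - 1"
        using LeastI[of "\<lambda>k. e k = length xs - 1", OF k(2)]
          Least_le[of "\<lambda>k. e k = length xs - 1", OF k(2)] k(1) 1(2) by simp
      fix m assume m: "e' m = length xs - 1"
      show "(LEAST k. e k = length xs - 1) \<le> m"
      proof (cases "m < length xs")
        case True
        then show ?thesis using m 1(2) by (intro Least_le) simp
      next
        case False
        then show ?thesis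
          using Least_le[of "\<lambda>k. e k = length xs - 1", OF k(2)] k(1) by linarith
      qed
    qed
    then show ?thesis using k 1(2) by (auto simp: mixed_choice_def)
  next
    case False
    then show ?thesis using 1(2) by (auto simp: mixed_choice_def)
  qed
  ultimately show ?case
    unfolding greedy.simps[of _ xs] by (simp only:)
qed

text \<open>Freezing coordinate \<open>n\<close> at a constant \<open>i\<close> leaves a function of
  the first \<open>n\<close> coordinates. The countably many values of \<open>i\<close> are then
  glued together along the measurable map giving coordinate \<open>n\<close>.\<close>

lemma measurable_finite_dependence:
  fixes e :: "'w \<Rightarrow> nat \<Rightarrow> nat"
  assumes "\<And>k. (\<lambda>\<omega>. e \<omega> k) \<in> measurable M (count_space UNIV)"
    and "\<And>f g. (\<And>k. k < n \<Longrightarrow> f k = g k) \<Longrightarrow> h f = h g"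
  shows "(\<lambda>\<omega>. h (e \<omega>)) \<in> measurable M (count_space UNIV)"
  using assms(2)
proof (induction n arbitrary: h)
  case 0
  then have "h (e \<omega>) = h (\<lambda>_. 0)" for \<omega> by blast
  then show ?case by simp
next
  case (Suc n)
  have "(\<lambda>\<omega>. h ((e \<omega>)(n := i))) \<in> measurable M (count_space UNIV)" for i
    by (rule Suc.IH[of "\<lambda>f. h (f(n := i))"]) (auto intro!: Suc.prems simp: less_Suc_eq)
  from measurable_compose_countable[of "\<lambda>i \<omega>. h ((e \<omega>)(n := i))", OF this assms(1)[of n]]
  show ?case by simp
qed

text \<open>Here \<open>S\<close> is the mixed run, \<open>Z\<close> the black-box run and
  \<open>E\<close> the set of exploration steps. Besides explorations and early errors, a step may
  hallucinate when \<open>Z\<close> repeats an earlier output of \<open>S\<close> and a substitute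
  is emitted; the bound has to absorb these collisions.\<close>

lemma card_hallucinations_le:
  fixes S Z :: "nat \<Rightarrow> 'u"
  assumes inj: "inj Z"
    and step: "\<And>n. n \<notin> E \<Longrightarrow> S n = Z n \<or> Z n \<in> S ` {..<n}"
    and K: "\<And>n. n \<ge> T \<Longrightarrow> Z n \<in> K"
  shows "card {n. n < t \<and> S n \<notin> K} \<le> card (E \<inter> {..<t}) + T"
proof -
  define Hal where "Hal = {n. n < t \<and> S n \<notin> K}"
  define N where "N = {n. n < t \<and> S n \<noteq> Z n}"
  define Col where "Col = {n \<in> N. n \<notin> E \<and> T \<le> n}"
  have fin: "finite Hal" "finite N" "finite Col"
    by (auto simp: Hal_def N_def Col_def)
  \<comment> \<open>A late collision is caused by an earlier deviation from \<open>Z\<close> that was no hallucination, and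
    distinct collisions have distinct causes.  So the collisions pay for themselves.\<close>
  have "\<exists>m<n. S m = Z n" if "n \<in> Col" for n
    using step[of n] that by (auto simp: Col_def N_def)
  then obtain g where g: "\<And>n. n \<in> Col \<Longrightarrow> g n < n \<and> S (g n) = Z n" by metis
  have "inj_on g Col"
    using g inj by (metis inj_onI injD)
  moreover have "g ` Col \<subseteq> N - Hal"
  proof
    fix m assume "m \<in> g ` Col"
    then obtain n where n: "n \<in> Col" "m = g n" by blast
    then have "Z m \<noteq> Z n" using g[of n] inj by (metis injD less_irrefl)
    then show "m \<in> N - Hal"
      using n g[of n] K[of n] by (auto simp: N_def Hal_def Col_def)
  qed
  ultimately have col: "card Col \<le> card (N - Hal)"
    using fin by (meson card_inj_on_le finite_Diff)
  have "N \<subseteq> E \<inter> {..<t} \<union> (N \<inter> {..<T} \<union> Col)"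
    by (auto simp: N_def Col_def)
  then have "card N \<le> card (E \<inter> {..<t} \<union> (N \<inter> {..<T} \<union> Col))"
    using fin by (intro card_mono) auto
  also have "\<dots> \<le> card (E \<inter> {..<t}) + (card (N \<inter> {..<T}) + card Col)"
    by (meson card_Un_le add_left_mono le_trans)
  finally have "card N \<le> card (E \<inter> {..<t}) + (card (N \<inter> {..<T}) + card Col)" .
  \<comment> \<open>Cancelling \<open>card (N - Hal)\<close> bounds the hallucinations inside
    \<open>N\<close>. Those outside \<open>N\<close> copy \<open>Z\<close> and hence precede
    \<open>T\<close>, so the two early parts add up to exactly \<open>T\<close>.\<close>
  moreover have "card N = card (N \<inter> Hal) + card (N - Hal)"
    using card_Int_Diff[OF fin(2)] .
  moreover have "card Hal = card (N \<inter> Hal) + card (Hal - N)"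
    using card_Int_Diff[OF fin(1), of N] by (simp add: Int_commute)
  moreover have "card (Hal - N) \<le> card ({..<T} - N)"
    using K by (intro card_mono) (auto simp: Hal_def N_def not_le[symmetric])
  moreover have "T = card (N \<inter> {..<T}) + card ({..<T} - N)"
    using card_Int_Diff[of "{..<T}" N] by (simp add: Int_commute)
  ultimately show ?thesis using col unfolding Hal_def[symmetric] by linarith
qed

definition block_times :: "(nat \<Rightarrow> nat) \<Rightarrow> (nat \<Rightarrow> nat) \<Rightarrow> bool" where
  "block_times s e \<longleftrightarrow> strict_mono s \<and> (\<forall>k. s k \<le> e k \<and> e k < s (Suc k))"

lemma block_times_strict_mono:
  assumes "block_times s e"
  shows "strict_mono e"
  using assms unfolding strict_mono_Suc_iff block_times_def by (meson less_le_trans)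

text \<open>Since \<open>e k \<ge> k\<close>, the bounded search of \<open>mixed_choice\<close>
  finds \<open>k\<close>, and strict monotonicity makes it the only hit.\<close>

lemma outputs_explore:
  assumes "block_times s e"
  shows "outputs (greedy (mixed_choice u e L b)) X (e k) =
    first_fresh u (L (multiplicity 2 (Suc k)))
      (X ` {..e k} \<union> outputs (greedy (mixed_choice u e L b)) X ` {..<e k})"
proof -
  have mono: "strict_mono e" using assms by (rule block_times_strict_mono)
  then have "k < Suc (e k)" using strict_mono_imp_increasing[of e k] by simp
  moreover have "(LEAST k'. e k' = e k) = k"
    using mono by (intro Least_equality) (auto simp: strict_mono_eq)
  ultimately show ?thesis
    by (subst outputs_greedy) (auto simp: mixed_choice_def)
qed

text \<open>The black-box output is unobserved, so it can be rejected only because it was already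
  output.\<close>

lemma outputs_exploit:
  assumes "n \<notin> range e" "outputs b X n \<notin> X ` {..n}"
  shows "outputs (greedy (mixed_choice u e L b)) X n = outputs b X n \<or>
    outputs b X n \<in> outputs (greedy (mixed_choice u e L b)) X ` {..<n}"
  using assms
  by (subst outputs_greedy) (auto simp: mixed_choice_def outputs_def[of b] simp del: upt_Suc)

text \<open>Suppose the element is missing at time \<open>d\<close>. Then
  \<open>\<tau> \<ge> d\<close>, as step \<open>\<tau>\<close> copies it or finds it already output.
  So it is unobserved and available before \<open>d\<close>, and each of the first
  \<open>j + 1\<close> explorations of \<open>L i\<close>, all before \<open>d\<close>, outputs an
  element listed before it. These outputs are distinct, but only \<open>j\<close> elements are
  listed before it.\<close>

lemma deadline_met:
  assumes u: "bij u" and L: "collection L" and e: "block_times s e"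
    and \<tau>: "outputs b X \<tau> = listing u (L i) j" "outputs b X \<tau> \<notin> X ` {..\<tau>}" "\<tau> \<notin> range e"
    and d: "s (2 ^ Suc i * Suc j) \<le> d"
  shows "listing u (L i) j \<in> outputs (greedy (mixed_choice u e L b)) X ` {..<d}"
proof (rule ccontr)
  let ?S = "outputs (greedy (mixed_choice u e L b)) X" and ?R = "listing u (L i)"
  assume no: "?R j \<notin> ?S ` {..<d}"
  have Li: "infinite (L i)" using L by (simp add: collection_def)
  have "d \<le> \<tau>"
  proof (rule ccontr)
    assume "\<not> d \<le> \<tau>"
    then have "?S \<tau> \<in> ?S ` {..<d}" "?S ` {..<\<tau>} \<subseteq> ?S ` {..<d}"
      by (auto intro!: image_mono)
    then show False
      using outputs_exploit[OF \<tau>(3,2), of u L] \<tau>(1) no by (metis subsetD)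
  qed
  \<comment> \<open>The zero-based index of the \<open>m\<close>-th exploration spent on
    \<open>L i\<close>: \<open>Suc (k m)\<close> runs through the odd multiples of
    \<open>2 ^ i\<close>.\<close>
  define k where "k m = 2 ^ i * (2 * m + 1) - (1 :: nat)" for m
  have Suc_k: "Suc (k m) = 2 ^ i * (2 * m + 1)" for m by (simp add: k_def)
  have lang: "multiplicity 2 (Suc (k m)) = i" for m
    unfolding Suc_k by (rule multiplicity_decomposeI[OF refl]) auto
  have smono: "strict_mono s" and e_less: "e k < s (Suc k)" for k
    using e by (auto simp: block_times_def)
  \<comment> \<open>A data model consisting of \<open>X\<close> alone yields freshness on
    \<open>X\<close> without any admissibility condition.\<close>
  have "generator (\<lambda>_. {X}) L (greedy (mixed_choice u e L b))"
    by (intro generator_greedy mixed_choice_notin u L)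
  then have gen: "?S n \<notin> ?S ` {..<n}" for n by (simp add: generator_def)
  have ek: "e (k m) < d" if "m \<le> j" for m
  proof -
    have "2 ^ i * (2 * m + 1) \<le> 2 ^ i * (2 * Suc j)"
      using that by (intro mult_le_mono) auto
    then have "Suc (k m) \<le> 2 ^ Suc i * Suc j"
      unfolding Suc_k by (simp only: power_Suc mult_ac)
    then have "s (Suc (k m)) \<le> s (2 ^ Suc i * Suc j)"
      using smono by (simp add: strict_mono_less_eq)
    then show ?thesis using e_less[of "k m"] d by linarith
  qed
  have "?S (e (k m)) \<in> ?R ` {..<j}" if m: "m \<le> j" for m
  proof -
    have "?R j \<notin> X ` {..e (k m)} \<union> ?S ` {..<e (k m)}"
      using ek[OF m] \<tau>(1,2) \<open>d \<le> \<tau>\<close> no by force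
    then have "?S (e (k m)) \<in> ?R ` {..j}"
      unfolding outputs_explore[OF e] lang by (rule first_fresh_le)
    moreover have "?S (e (k m)) \<noteq> ?R j"
      using ek[OF m] no by force
    ultimately show ?thesis by (auto simp: le_less)
  qed
  then have "(\<lambda>m. ?S (e (k m))) ` {..j} \<subseteq> ?R ` {..<j}" by auto
  moreover have "inj_on (\<lambda>m. ?S (e (k m))) {..j}"
  proof -
    have "inj ?S" using gen by (rule inj_if_fresh)
    moreover have "inj e" using block_times_strict_mono[OF e] by (rule strict_mono_imp_inj_on)
    moreover have "inj k"
    proof (rule injI)
      fix m m' assume "k m = k m'"
      then have "2 ^ i * (2 * m + 1) = 2 ^ i * (2 * m' + 1)" by (simp only: Suc_k[symmetric])
      then show "m = m'" by simp
    qed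
    ultimately have "inj (?S \<circ> (e \<circ> k))" by (intro inj_compose)
    then show ?thesis unfolding comp_def by (rule inj_on_subset) simp
  qed
  ultimately have "card {..j} \<le> card (?R ` {..<j})"
    by (meson card_inj_on_le finite_imageI finite_lessThan)
  also have "\<dots> \<le> j" using card_image_le[of "{..<j}" ?R] by simp
  finally show False by simp
qed

subsection \<open>Randomly placed explorations\<close>

text \<open>Independent uniform offsets, one per block, stored as reals so that a sample point has
  type \<open>nat \<Rightarrow> real\<close>.\<close>

definition exploration_measure :: "(nat \<Rightarrow> nat) \<Rightarrow> (nat \<Rightarrow> real) measure" where
  "exploration_measure s =
     PiM UNIV (\<lambda>k. measure_pmf (map_pmf real (pmf_of_set {..<s (Suc k) - s k})))"

text \<open>Reducing modulo the block length makes the step fall into its block for every \<open>\<omega>\<close>, not just almost surely.\<close>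

definition exploration_time :: "(nat \<Rightarrow> nat) \<Rightarrow> (nat \<Rightarrow> real) \<Rightarrow> nat \<Rightarrow> nat" where
  "exploration_time s \<omega> k = s k + nat \<lfloor>\<omega> k\<rfloor> mod (s (Suc k) - s k)"

lemma block_times_exploration_time:
  assumes "strict_mono s"
  shows "block_times s (exploration_time s \<omega>)"
proof -
  have "nat \<lfloor>\<omega> k\<rfloor> mod (s (Suc k) - s k) < s (Suc k) - s k" for k
    using strict_monoD[OF assms, of k "Suc k"] by simp
  then show ?thesis
    using assms by (auto simp: block_times_def exploration_time_def less_diff_conv add.commute)
qed

lemma prob_space_exploration_measure: "prob_space (exploration_measure s)"
  unfolding exploration_measure_def by (intro prob_space_PiM prob_space_measure_pmf)

lemma measurable_exploration_time:
  "(\<lambda>\<omega>. exploration_time s \<omega> k) \<in> measurable (exploration_measure s) (count_space UNIV)"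
proof -
  have "(\<lambda>\<omega>. \<omega> k) \<in> measurable (exploration_measure s)
      (measure_pmf (map_pmf real (pmf_of_set {..<s (Suc k) - s k})))"
    unfolding exploration_measure_def by (rule measurable_component_singleton) simp
  then show ?thesis
    unfolding exploration_time_def by (rule measurable_compose) simp
qed

text \<open>The joint law of the coordinates is the product of their marginals. This criterion is
  applied to nonempty index sets; the empty one is settled by definition.\<close>

lemma indep_vars_PiM_component:
  assumes "\<And>i. i \<in> I \<Longrightarrow> prob_space (N i)"
  shows "prob_space.indep_vars (PiM I N) N (\<lambda>i \<omega>. \<omega> i) I"
proof -
  interpret prob_space "PiM I N" using assms by (rule prob_space_PiM)
  show ?thesis
  proof (cases "I = {}")
    case True
    then show ?thesis using prob_space_axioms by (auto simp: prob_space.indep_vars_def prob_space.indep_sets_def)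
  next
    case False
    have "distr (PiM I N) (PiM I N) (\<lambda>\<omega>. \<lambda>i\<in>I. \<omega> i) = distr (PiM I N) (PiM I N) (\<lambda>\<omega>. \<omega>)"
      by (intro distr_cong) (auto simp: space_PiM)
    also have "\<dots> = PiM I N" by simp
    also have "\<dots> = PiM I (\<lambda>i. distr (PiM I N) (N i) (\<lambda>\<omega>. \<omega> i))"
      using assms by (intro PiM_cong) (auto simp: distr_PiM_component)
    finally show ?thesis
      using False by (subst indep_vars_iff_distr_eq_PiM') auto
  qed
qed

lemma indep_vars_exploration_time:
  "prob_space.indep_vars (exploration_measure s) (\<lambda>_. count_space UNIV)
     (\<lambda>k \<omega>. exploration_time s \<omega> k) UNIV"
proof -
  interpret prob_space "exploration_measure s" by (rule prob_space_exploration_measure)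
  have "indep_vars (\<lambda>k. measure_pmf (map_pmf real (pmf_of_set {..<s (Suc k) - s k})))
      (\<lambda>k \<omega>. \<omega> k) UNIV"
    unfolding exploration_measure_def
    by (intro indep_vars_PiM_component prob_space_measure_pmf)
  then show ?thesis
    unfolding exploration_time_def by (rule indep_vars_compose2) simp
qed

lemma prob_exploration_time:
  assumes "strict_mono s"
  shows "measure (exploration_measure s) {\<omega> \<in> space (exploration_measure s). exploration_time s \<omega> k \<in> A} =
    real (card (A \<inter> {s k..<s (Suc k)})) / real (s (Suc k) - s k)"
proof -
  let ?l = "s (Suc k) - s k"
  let ?N = "\<lambda>k. measure_pmf (map_pmf real (pmf_of_set {..<s (Suc k) - s k}))"
  have l: "?l > 0" using strict_monoD[OF assms, of k "Suc k"] by simp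
  define B where "B = {x :: real. s k + nat \<lfloor>x\<rfloor> mod ?l \<in> A}"
  have "{\<omega> \<in> space (exploration_measure s). exploration_time s \<omega> k \<in> A} =
      (\<lambda>\<omega>. \<omega> k) -` B \<inter> space (PiM UNIV ?N)"
    by (auto simp: exploration_measure_def exploration_time_def B_def)
  then have "measure (exploration_measure s) {\<omega> \<in> space (exploration_measure s). exploration_time s \<omega> k \<in> A} =
      measure (distr (PiM UNIV ?N) (?N k) (\<lambda>\<omega>. \<omega> k)) B"
    by (subst measure_distr) (auto simp: exploration_measure_def)
  also have "\<dots> = measure (?N k) B"
    by (subst distr_PiM_component) (auto intro: prob_space_measure_pmf)
  also have "\<dots> = measure (pmf_of_set {..<?l}) (real -` B)"
    by simp
  also have "\<dots> = real (card ({..<?l} \<inter> real -` B)) / real ?l"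
    using l by (subst measure_pmf_of_set) (auto simp: lessThan_empty_iff)
  \<comment> \<open>Rounding and reduction do nothing to naturals below the block length, so the
    shift by \<open>s k\<close> is a bijection.\<close>
  also have "card ({..<?l} \<inter> real -` B) = card (A \<inter> {s k..<s (Suc k)})"
  proof (rule bij_betw_same_card)
    show "bij_betw (\<lambda>m. s k + m) ({..<?l} \<inter> real -` B) (A \<inter> {s k..<s (Suc k)})"
      by (rule bij_betwI[where g = "\<lambda>n. n - s k"]) (auto simp: B_def)
  qed
  finally show ?thesis .
qed

lemma sum_card_blocks_le:
  fixes s :: "nat \<Rightarrow> nat"
  assumes "strict_mono s" "finite A" "finite I"
  shows "(\<Sum>k\<in>I. card (A \<inter> {s k..<s (Suc k)})) \<le> card A"
proof -
  have "disjoint_family_on (\<lambda>k. A \<inter> {s k..<s (Suc k)}) I"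
  proof (unfold disjoint_family_on_def, intro ballI impI)
    fix k l :: nat assume "k \<noteq> l"
    then consider "Suc k \<le> l" | "Suc l \<le> k" by linarith
    then show "A \<inter> {s k..<s (Suc k)} \<inter> (A \<inter> {s l..<s (Suc l)}) = {}"
    proof cases
      case 1
      then have "s (Suc k) \<le> s l" using assms(1) by (simp add: strict_mono_less_eq)
      then show ?thesis by auto
    next
      case 2
      then have "s (Suc l) \<le> s k" using assms(1) by (simp add: strict_mono_less_eq)
      then show ?thesis by auto
    qed
  qed
  then have "(\<Sum>k\<in>I. card (A \<inter> {s k..<s (Suc k)})) = card (\<Union>k\<in>I. A \<inter> {s k..<s (Suc k)})"
    using assms(2,3) by (intro card_UN_disjoint[symmetric]) (auto simp: disjoint_family_on_def)
  also have "\<dots> \<le> card A" using assms(2) by (intro card_mono) auto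
  finally show ?thesis .
qed

text \<open>The count is a sum of independent indicators, one for each block meeting
  \<open>A\<close>. Blocks before \<open>m\<close> add at most 1 each to the mean, and a later block
  adds at most \<open>\<epsilon>\<close> times its share of \<open>A\<close>, so the mean is at most
  \<open>2 * \<epsilon> * n\<close>. Hoeffding's inequality bounds a further deviation by
  \<open>\<epsilon> * n\<close>.\<close>

lemma prob_many_explorations:
  assumes s: "strict_mono s" and \<epsilon>: "\<epsilon> > 0"
    and long: "\<And>k. k \<ge> m \<Longrightarrow> 1 \<le> \<epsilon> * real (s (Suc k) - s k)"
    and A: "finite A" "card A \<le> n" and n: "n \<ge> 1" "real m \<le> \<epsilon> * real n"
  shows "measure (exploration_measure s) {\<omega> \<in> space (exploration_measure s).
      real (card {k. exploration_time s \<omega> k \<in> A}) \<ge> 3 * \<epsilon> * real n} \<le> exp (- 2 * \<epsilon>\<^sup>2 * real n)"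
    (is "measure ?M ?E \<le> _")
proof -
  interpret prob_space ?M by (rule prob_space_exploration_measure)
  define a where "a k = card (A \<inter> {s k..<s (Suc k)})" for k
  define I where "I = {k. a k > 0}"
  have bt: "s k \<le> exploration_time s \<omega> k \<and> exploration_time s \<omega> k < s (Suc k)" for \<omega> k
    using block_times_exploration_time[OF s] by (simp add: block_times_def)
  have "k \<le> s k" for k using s by (rule strict_mono_imp_increasing)
  \<comment> \<open>Block \<open>k\<close> starts no earlier than time \<open>k\<close>. Inserting 0
    covers an empty \<open>A\<close>.\<close>
  then have "I \<subseteq> {..Max (insert 0 A)}"
    using A(1) by (fastforce simp: I_def a_def card_gt_0_iff intro: order_trans Max_ge)
  then have finI: "finite I" using finite_subset by blast
  have sum_a: "(\<Sum>k\<in>I. a k) \<le> n"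
    using sum_card_blocks_le[OF s A(1) finI] A(2) by (simp add: a_def)
  have "card I \<le> (\<Sum>k\<in>I. a k)"
    using sum_mono[of I "\<lambda>_. 1" a] by (simp add: I_def Suc_le_eq)
  with sum_a have cardI: "card I \<le> n" by simp
  define X where "X k \<omega> = (of_bool (exploration_time s \<omega> k \<in> A) :: real)" for k \<omega>
  have count: "real (card {k. exploration_time s \<omega> k \<in> A}) = (\<Sum>k\<in>I. X k \<omega>)" for \<omega>
  proof -
    have "{k. exploration_time s \<omega> k \<in> A} = {k \<in> I. exploration_time s \<omega> k \<in> A}"
      using bt[of _ \<omega>] A(1) by (force simp: I_def a_def card_gt_0_iff)
    then show ?thesis using finI by (simp add: X_def of_bool_def sum.If_cases Int_def)
  qed
  show ?thesis
  proof (cases "I = {}")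
    case True
    then have "?E = {}" using \<epsilon> n(1) by (auto simp: count not_le)
    then show ?thesis by (simp only: measure_empty exp_ge_zero)
  next
    case False
    have indep: "indep_vars (\<lambda>_. borel) X I"
    proof -
      have "indep_vars (\<lambda>_. count_space UNIV) (\<lambda>k \<omega>. exploration_time s \<omega> k) I"
        using indep_vars_exploration_time by (rule indep_vars_subset) simp
      then show ?thesis unfolding X_def by (rule indep_vars_compose2) simp
    qed
    interpret H: Hoeffding_ineq ?M I X "\<lambda>_. 0" "\<lambda>_. 1" "\<Sum>k\<in>I. expectation (X k)"
      by unfold_locales (auto simp: finI indep X_def)
    have expX: "expectation (X k) = real (a k) / real (s (Suc k) - s k)" for k
    proof -
      have "{\<omega> \<in> space ?M. exploration_time s \<omega> k \<in> A} \<in> sets ?M"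
        using measurable_sets[OF measurable_exploration_time[of s k], of A]
        by (simp add: vimage_def Int_def conj_commute)
      then have "expectation (indicator {\<omega> \<in> space ?M. exploration_time s \<omega> k \<in> A}) =
          prob {\<omega> \<in> space ?M. exploration_time s \<omega> k \<in> A}"
        by simp
      moreover have "expectation (X k) = expectation (indicator {\<omega> \<in> space ?M. exploration_time s \<omega> k \<in> A})"
        by (intro Bochner_Integration.integral_cong) (auto simp: X_def)
      ultimately show ?thesis using prob_exploration_time[OF s, of k A] by (simp add: a_def)
    qed
    have expX_le: "expectation (X k) \<le> of_bool (k < m) + \<epsilon> * real (a k)" for k
    proof -
      have pos: "real (s (Suc k) - s k) > 0" using strict_monoD[OF s, of k "Suc k"] by simp
      show ?thesis
      proof (cases "k < m")
        case True
        have "a k \<le> card {s k..<s (Suc k)}" unfolding a_def by (intro card_mono) auto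
        then have "expectation (X k) \<le> 1" using pos by (simp add: expX)
        then show ?thesis using True \<epsilon> by (simp add: add_increasing2)
      next
        case False
        then have "real (a k) * 1 \<le> real (a k) * (\<epsilon> * real (s (Suc k) - s k))"
          using long by (intro mult_left_mono) auto
        then show ?thesis using False pos by (simp add: expX divide_le_eq mult_ac)
      qed
    qed
    have "(\<Sum>k\<in>I. expectation (X k)) \<le> (\<Sum>k\<in>I. of_bool (k < m) + \<epsilon> * real (a k))"
      by (intro sum_mono expX_le)
    also have "\<dots> = (\<Sum>k\<in>I. of_bool (k < m)) + \<epsilon> * (\<Sum>k\<in>I. real (a k))"
      by (simp add: sum.distrib sum_distrib_left)
    also have "(\<Sum>k\<in>I. of_bool (k < m)) \<le> real m"
    proof -
      have "(\<Sum>k\<in>I. of_bool (k < m)) = real (card {k \<in> I. k < m})"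
        using finI by (simp add: of_bool_def sum.If_cases Int_def)
      also have "card {k \<in> I. k < m} \<le> card {..<m}" by (intro card_mono) auto
      finally show ?thesis by simp
    qed
    also have "\<epsilon> * (\<Sum>k\<in>I. real (a k)) \<le> \<epsilon> * real n"
      using sum_a \<epsilon> by (intro mult_left_mono) (auto simp flip: of_nat_sum)
    finally have mean: "(\<Sum>k\<in>I. expectation (X k)) \<le> 2 * \<epsilon> * real n" using n(2) by simp
    have "prob ?E \<le> prob {\<omega> \<in> space ?M. (\<Sum>k\<in>I. X k \<omega>) \<ge> (\<Sum>k\<in>I. expectation (X k)) + \<epsilon> * real n}"
      using mean by (intro finite_measure_mono) (auto simp: count intro: H.random_variable)
    also have "\<dots> \<le> exp (- 2 * (\<epsilon> * real n)\<^sup>2 / (\<Sum>k\<in>I. (1 - 0)\<^sup>2))"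
      using \<epsilon> False finI by (intro H.Hoeffding_ineq_ge) (auto simp: card_gt_0_iff)
    also have "\<dots> \<le> exp (- 2 * \<epsilon>\<^sup>2 * real n)"
    proof -
      \<comment> \<open>At most \<open>n\<close> blocks meet \<open>A\<close>, which turns the
        Hoeffding exponent into one linear in \<open>n\<close>.\<close>
      have "(2 * \<epsilon>\<^sup>2 * real n) * real (card I) \<le> (2 * \<epsilon>\<^sup>2 * real n) * real n"
        using cardI by (intro mult_left_mono) auto
      moreover have "real (card I) > 0" using False finI by (simp add: card_gt_0_iff)
      ultimately have "2 * \<epsilon>\<^sup>2 * real n \<le> 2 * (\<epsilon> * real n)\<^sup>2 / real (card I)"
        by (simp only: pos_le_divide_eq power_mult_distrib power2_eq_square[of "real n"] mult_ac)
      then show ?thesis by simp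
    qed
    finally show ?thesis .
  qed
qed

text \<open>For fixed \<open>\<epsilon>\<close> the tail bounds form a convergent geometric series,
  so by Borel-Cantelli the ratio is almost surely eventually below \<open>3 * \<epsilon>\<close>.
  The sets \<open>A n\<close> must not depend on \<open>\<omega>\<close>.\<close>

lemma AE_explorations_negligible:
  assumes s: "strict_mono s" "filterlim (\<lambda>k. s (Suc k) - s k) at_top sequentially"
    and A: "\<And>n. finite (A n)" "\<And>n. card (A n) \<le> n"
  shows "AE \<omega> in exploration_measure s.
    (\<lambda>n. real (card {k. exploration_time s \<omega> k \<in> A n}) / real n) \<longlonglongrightarrow> 0"
proof -
  let ?M = "exploration_measure s"
  interpret prob_space ?M by (rule prob_space_exploration_measure)
  have small: "AE \<omega> in ?M. \<forall>\<^sub>F n in sequentially.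
      real (card {k. exploration_time s \<omega> k \<in> A n}) / real n < 3 * \<epsilon>" if \<epsilon>: "\<epsilon> > 0" for \<epsilon>
  proof -
    have "\<forall>\<^sub>F k in sequentially. nat \<lceil>1 / \<epsilon>\<rceil> \<le> s (Suc k) - s k"
      using s(2) unfolding filterlim_at_top by blast
    then obtain m where m: "\<And>k. k \<ge> m \<Longrightarrow> nat \<lceil>1 / \<epsilon>\<rceil> \<le> s (Suc k) - s k"
      by (auto simp: eventually_sequentially)
    have long: "1 \<le> \<epsilon> * real (s (Suc k) - s k)" if "k \<ge> m" for k
    proof -
      have "1 / \<epsilon> \<le> real (s (Suc k) - s k)" using m[OF that] by linarith
      then show ?thesis using \<epsilon> by (simp add: divide_le_eq mult.commute del: of_nat_diff)
    qed
    define n0 where "n0 = Suc (nat \<lceil>real m / \<epsilon>\<rceil>)"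
    have n0: "n \<ge> 1 \<and> real m \<le> \<epsilon> * real n" if "n \<ge> n0" for n
    proof -
      have "real m / \<epsilon> \<le> real n" using that unfolding n0_def by linarith
      then show ?thesis using \<epsilon> that by (simp add: divide_le_eq mult.commute n0_def)
    qed
    define E where "E n = {\<omega> \<in> space ?M.
      real (card {k. exploration_time s \<omega> k \<in> A n}) \<ge> 3 * \<epsilon> * real n}" for n
    have E: "E n \<in> sets ?M" for n
    proof -
      \<comment> \<open>Exploration \<open>k\<close> happens no earlier than time \<open>k\<close>,
        so the count is a finite sum over a range independent of \<open>\<omega>\<close>, hence
        measurable.\<close>
      have "real (card {k. exploration_time s \<omega> k \<in> A n}) =
          (\<Sum>k\<le>Max (insert 0 (A n)). of_bool (exploration_time s \<omega> k \<in> A n))" for \<omega>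
      proof -
        have "k \<le> Max (insert 0 (A n))" if "exploration_time s \<omega> k \<in> A n" for k
        proof -
          have "k \<le> exploration_time s \<omega> k"
            using strict_mono_imp_increasing[OF block_times_strict_mono[OF block_times_exploration_time[OF s(1)]]] .
          also have "\<dots> \<le> Max (insert 0 (A n))" using that A(1) by (intro Max_ge) auto
          finally show ?thesis .
        qed
        then have "{k. exploration_time s \<omega> k \<in> A n} =
            {k \<in> {..Max (insert 0 (A n))}. exploration_time s \<omega> k \<in> A n}" by auto
        then show ?thesis by (simp add: of_bool_def sum.If_cases Int_def)
      qed
      moreover have "(\<lambda>\<omega>. \<Sum>k\<le>Max (insert 0 (A n)). (of_bool (exploration_time s \<omega> k \<in> A n) :: real))
          \<in> borel_measurable ?M"
        by (intro borel_measurable_sum measurable_compose[OF measurable_exploration_time]) simp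
      ultimately show ?thesis unfolding E_def by simp
    qed
    have "AE \<omega> in ?M. \<forall>\<^sub>F n in sequentially. \<omega> \<in> space ?M - E n"
    proof (rule borel_cantelli_AE1[OF E])
      show "summable (\<lambda>n. prob (E n))"
      proof (rule summable_comparison_test)
        show "\<exists>N. \<forall>n\<ge>N. norm (prob (E n)) \<le> exp (- 2 * \<epsilon>\<^sup>2) ^ n"
        proof (intro exI allI impI)
          fix n assume "n0 \<le> n"
          then have "prob (E n) \<le> exp (- 2 * \<epsilon>\<^sup>2 * real n)"
            unfolding E_def using n0[of n] by (intro prob_many_explorations[OF s(1) \<epsilon> long A]) auto
          also have "\<dots> = exp (- 2 * \<epsilon>\<^sup>2) ^ n" by (simp add: exp_of_nat_mult[symmetric] mult.commute)
          finally show "norm (prob (E n)) \<le> exp (- 2 * \<epsilon>\<^sup>2) ^ n" by simp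
        qed
        show "summable (\<lambda>n. exp (- 2 * \<epsilon>\<^sup>2) ^ n)"
          using \<epsilon> by (intro summable_geometric) simp
      qed
    qed (simp add: emeasure_eq_measure)
    then show ?thesis
    proof eventually_elim
      case (elim \<omega>)
      show ?case
        using elim eventually_gt_at_top[of "0 :: nat"]
      proof eventually_elim
        case (elim n)
        then show ?case by (auto simp: E_def not_le divide_less_eq mult_ac)
      qed
    qed
  qed
  \<comment> \<open>Countably many values of \<open>\<epsilon>\<close> suffice for convergence and
    share one null set.\<close>
  have "AE \<omega> in ?M. \<forall>i :: nat. \<forall>\<^sub>F n in sequentially.
      real (card {k. exploration_time s \<omega> k \<in> A n}) / real n < 3 * (1 / real (Suc i))"
    unfolding AE_all_countable by (intro allI small) simp
  then show ?thesis
  proof eventually_elim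
    case (elim \<omega>)
    show ?case
    proof (rule LIMSEQ_I)
      fix r :: real assume "r > 0"
      then obtain i where i: "1 / real (Suc i) < r / 3"
        using reals_Archimedean[of "r / 3"] by (auto simp: inverse_eq_divide)
      obtain N where "\<And>n. n \<ge> N \<Longrightarrow>
          real (card {k. exploration_time s \<omega> k \<in> A n}) / real n < 3 * (1 / real (Suc i))"
        using elim by (auto simp: eventually_sequentially)
      then have "\<forall>n\<ge>N. norm (real (card {k. exploration_time s \<omega> k \<in> A n}) / real n - 0) < r"
        using i by (fastforce intro: less_trans)
      then show "\<exists>N. \<forall>n\<ge>N. norm (real (card {k. exploration_time s \<omega> k \<in> A n}) / real n - 0) < r"
        by blast
    qed
  qed
qed

subsection \<open>Density and hallucination rate\<close>

lemma deadline_density_eq: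
  "deadline_density i S R D = real (card {j. j < i \<and> R j \<in> S ` {..<D (Suc j)}}) / real i"
proof -
  have "(\<Sum>j=1..i. of_bool (R (j - 1) \<in> first_n S (D j)) :: real) =
      (\<Sum>j<i. of_bool (R j \<in> S ` {..<D (Suc j)}))"
    by (simp only: One_nat_def sum.atLeast1_atMost_eq first_n_def diff_Suc_Suc diff_zero)
  also have "\<dots> = real (card {j. j < i \<and> R j \<in> S ` {..<D (Suc j)}})"
    by (simp add: Int_def)
  finally show ?thesis by (simp only: deadline_density_def)
qed

text \<open>A listed element that \<open>Z\<close> outputs meets its deadline unless it is among the
  first \<open>j0\<close> or \<open>Z\<close> outputs it at an exploration step. Both exceptions
  have density 0.\<close>

lemma deadline_density_liminf:
  fixes Z S :: "nat \<Rightarrow> 'u"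
  assumes Z: "inj Z" and e: "inj e"
    and dens: "ereal a \<le> set_density u (range Z) K"
    and lost: "(\<lambda>n. real (card {k. e k \<in> Z -` listing u K ` {..<n}}) / real n) \<longlonglongrightarrow> 0"
    and met: "\<forall>\<^sub>F j in sequentially. \<forall>n. n \<notin> range e \<longrightarrow> Z n = listing u K j \<longrightarrow>
      listing u K j \<in> S ` {..<D (Suc j)}"
  shows "ereal a \<le> liminf (\<lambda>i. ereal (deadline_density i S (listing u K) D))"
proof -
  let ?R = "listing u K"
  obtain j0 where j0: "\<And>j n. j \<ge> j0 \<Longrightarrow> n \<notin> range e \<Longrightarrow> Z n = ?R j \<Longrightarrow> ?R j \<in> S ` {..<D (Suc j)}"
    using met unfolding eventually_sequentially by blast
  define lst where "lst i = card {k. e k \<in> Z -` ?R ` {..<i}}" for i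
  have main: "card (range Z \<inter> first_n ?R i) \<le>
      card {j. j < i \<and> ?R j \<in> S ` {..<D (Suc j)}} + (j0 + lst i)" for i
  proof -
    let ?G = "{j. j < i \<and> ?R j \<in> S ` {..<D (Suc j)}}"
    let ?P = "{k. e k \<in> Z -` ?R ` {..<i}}"
    have fin: "finite ?P"
    proof -
      have "finite (e -` (Z -` ?R ` {..<i}))" by (intro finite_vimageI e Z) simp
      then show ?thesis by (simp add: vimage_def)
    qed
    have "range Z \<inter> first_n ?R i \<subseteq> ?R ` ?G \<union> (?R ` {..<j0} \<union> (\<lambda>k. Z (e k)) ` ?P)"
    proof
      fix x assume "x \<in> range Z \<inter> first_n ?R i"
      then obtain n j where x: "x = Z n" "x = ?R j" "j < i" unfolding first_n_def by blast
      show "x \<in> ?R ` ?G \<union> (?R ` {..<j0} \<union> (\<lambda>k. Z (e k)) ` ?P)"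
      proof (cases "n \<in> range e")
        case True
        then obtain k where k: "n = e k" by blast
        then have "Z (e k) \<in> ?R ` {..<i}" using x by (metis imageI lessThan_iff)
        then show ?thesis using x k by blast
      next
        case False
        then have "j < j0 \<or> j \<in> ?G" using x j0[of j n] by (cases "j < j0") auto
        then show ?thesis using x(2) by blast
      qed
    qed
    then have "card (range Z \<inter> first_n ?R i) \<le> card (?R ` ?G \<union> (?R ` {..<j0} \<union> (\<lambda>k. Z (e k)) ` ?P))"
      using fin by (intro card_mono) auto
    also have "\<dots> \<le> card (?R ` ?G) + (card (?R ` {..<j0}) + card ((\<lambda>k. Z (e k)) ` ?P))"
      by (meson card_Un_le add_left_mono le_trans)
    also have "\<dots> \<le> card ?G + (card {..<j0} + card ?P)"
      using fin by (intro add_mono card_image_le) auto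
    finally show ?thesis by (simp add: lst_def)
  qed
  show ?thesis
    unfolding le_Liminf_iff
  proof (intro allI impI)
    fix y assume "y < ereal a"
    then obtain r where r: "y < ereal r" "r < a" using ereal_dense2 by force
    \<comment> \<open>The gap between \<open>r\<close> and \<open>r'\<close> will absorb the
      vanishing fraction of exceptions.\<close>
    then obtain r' where r': "r < r'" "r' < a" using dense by blast
    have "\<forall>\<^sub>F i in sequentially. ereal r' < ereal (real (card (range Z \<inter> first_n ?R i)) / real i)"
      using dens[unfolded set_density_def le_Liminf_iff, rule_format, of "ereal r'"] r'(2) by simp
    moreover have "(\<lambda>i. real j0 / real i + real (lst i) / real i) \<longlonglongrightarrow> 0 + 0"
      using lost unfolding lst_def by (intro tendsto_add lim_const_over_n)
    then have "\<forall>\<^sub>F i in sequentially. real j0 / real i + real (lst i) / real i < r' - r"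
      using r'(1) by (intro order_tendstoD(2)) auto
    ultimately show "\<forall>\<^sub>F i in sequentially. y < ereal (deadline_density i S ?R D)"
    proof eventually_elim
      case (elim i)
      have "real (card (range Z \<inter> first_n ?R i)) / real i \<le>
          real (card {j. j < i \<and> ?R j \<in> S ` {..<D (Suc j)}} + (j0 + lst i)) / real i"
        using main[of i] by (intro divide_right_mono) (simp_all only: of_nat_le_iff of_nat_0_le_iff)
      then have "r < deadline_density i S ?R D"
        using elim by (simp add: deadline_density_eq add_divide_distrib)
      then show ?case using r(1) by (meson ereal_less_eq(3) less_le_trans less_imp_le)
    qed
  qed
qed

text \<open>No measurability has to be shown: the integral of a non-integrable function is 0 by
  convention, which \<open>c \<ge> 0\<close> covers.\<close>

lemma (in prob_space) integral_le_bound: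
  assumes "\<And>x. x \<in> space M \<Longrightarrow> f x \<le> c" "0 \<le> (c :: real)"
  shows "(\<integral>x. f x \<partial>M) \<le> c"
proof (cases "integrable M f")
  case True
  then show ?thesis using assms(1) by (intro integral_le_const AE_I2) auto
next
  case False
  then show ?thesis using assms(2) by (simp add: not_integrable_integral_eq)
qed

text \<open>If \<open>b\<close> is the last block begun before \<open>t\<close>, at most
  \<open>b + 1\<close> blocks have begun, and the last clause of the schedule applies to
  \<open>b\<close>.\<close>

lemma schedule_budget:
  assumes "exploration_schedule D H s"
  shows "\<forall>\<^sub>F t in sequentially. real (card {k. s k < t} + T) / real t \<le> H t"
proof -
  have mono: "strict_mono s" using assms by (simp add: exploration_schedule_def)
  obtain b0 where b0: "\<And>b t. b \<ge> b0 \<Longrightarrow> s b < t \<Longrightarrow> real (b + T + 1) \<le> real t * H t"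
    using assms unfolding exploration_schedule_def eventually_sequentially by blast
  show ?thesis
    using eventually_gt_at_top[of "s b0"]
  proof eventually_elim
    case (elim t)
    let ?B = "{k. s k < t}"
    have fin: "finite ?B"
      by (rule finite_subset[of _ "{..t}"])
        (auto intro: order_trans[OF strict_mono_imp_increasing[OF mono]])
    define b where "b = Max ?B"
    have b: "b0 \<le> b" "s b < t"
      using fin elim Max_in[OF fin] unfolding b_def by (auto intro: Max_ge)
    have "card ?B \<le> card {..b}"
      using fin by (intro card_mono) (auto simp: b_def)
    then have "real (card ?B + T) \<le> real (b + T + 1)" by simp
    also have "\<dots> \<le> real t * H t" using b0 b by blast
    finally show ?case using elim by (simp add: divide_le_eq mult.commute)
  qed
qed

text \<open>The rate bound holds from a time uniform over all inputs on which the black box is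
  consistent from \<open>T\<close>. By \<open>no_uniform_hallucination_bound\<close>, a time uniform
  over all admissible inputs cannot exist for every collection, because \<open>H\<close> tends to
  0.\<close>

theorem theorem9:
  fixes u :: "nat \<Rightarrow> 'u" and \<alpha> :: real and D :: "nat \<Rightarrow> nat" and H :: "nat \<Rightarrow> real"
  assumes "bij u" and "\<alpha> \<in> {0..1}" and "feasible_profile D H"
  shows "\<exists>(M :: (nat \<Rightarrow> real) measure) A.
    (\<forall>L. \<forall>\<omega>\<in>space M. black_box (\<lambda>b. A L b \<omega>)) \<and>
    (\<forall>B. kleinberg_wei u B \<longrightarrow>
      (\<forall>L. collection L \<longrightarrow>
        randomized_generator (part_enum u \<alpha>) L M (A L (B L)) \<and>
        (\<forall>K\<in>range L. \<forall>X\<in>part_enum u \<alpha> K.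
          AE \<omega> in M. ereal (\<alpha> / 2) \<le>
            liminf (\<lambda>i. ereal (deadline_density i (outputs (A L (B L) \<omega>) X) (listing u K) D))) \<and>
        (\<forall>T. \<forall>\<^sub>F t in sequentially.
          (SUP K\<in>range L. SUP X\<in>{X \<in> part_enum u \<alpha> K. consistent_from (B L) X K T}.
             ereal (hallucination_rate M (A L (B L)) K X t)) \<le> ereal (H t))))"
proof -
  obtain s where s: "exploration_schedule D H s"
    using exploration_schedule_exists[OF assms(3)] .
  then have mono: "strict_mono s"
    and long: "filterlim (\<lambda>k. s (Suc k) - s k) at_top sequentially"
    and early: "\<And>C. \<forall>\<^sub>F j in sequentially. s (C * j) \<le> D j"
    by (auto simp: exploration_schedule_def)
  let ?M = "exploration_measure s" and ?e = "exploration_time s"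
  define A where "A L b \<omega> = greedy (mixed_choice u (?e \<omega>) L b)" for L b \<omega>
  interpret prob_space ?M by (rule prob_space_exploration_measure)
  have bt: "block_times s (?e \<omega>)" for \<omega>
    using mono by (rule block_times_exploration_time)
  have inj_e: "inj (?e \<omega>)" for \<omega>
    using block_times_strict_mono[OF bt] by (rule strict_mono_imp_inj_on)
  have rand: "randomized_generator (part_enum u \<alpha>) L ?M (A L b)" if L: "collection L" for L b
  proof -
    have "(\<lambda>\<omega>. A L b \<omega> xs) \<in> measurable ?M (count_space UNIV)" for xs
      unfolding A_def
      by (rule measurable_finite_dependence[where n = "length xs" and
            h = "\<lambda>e. greedy (mixed_choice u e L b) xs"])
        (auto intro: measurable_exploration_time greedy_mixed_schedule_cong)
    then show ?thesis
      unfolding randomized_generator_def A_def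
      using prob_space_axioms generator_greedy mixed_choice_notin[OF assms(1) L] by blast
  qed
  have run: "inj (outputs (B L) X) \<and> (\<forall>n. outputs (B L) X n \<notin> X ` {..n})"
    if "kleinberg_wei u B" "collection L" "K \<in> range L" "X \<in> part_enum u \<alpha> K" for B L K X
  proof -
    have "generator (part_enum u \<alpha>) L (B L)"
      using that(1,2) assms(2) unfolding kleinberg_wei_def by blast
    then have "outputs (B L) X n \<notin> outputs (B L) X ` {..<n}" "outputs (B L) X n \<notin> X ` {..n}" for n
      using that(3,4) unfolding generator_def by blast+
    then show ?thesis using inj_if_fresh by blast
  qed
  have dens: "AE \<omega> in ?M. ereal (\<alpha> / 2) \<le>
      liminf (\<lambda>i. ereal (deadline_density i (outputs (A L (B L) \<omega>) X) (listing u K) D))"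
    if kw: "kleinberg_wei u B" and L: "collection L" and K: "K \<in> range L"
      and X: "X \<in> part_enum u \<alpha> K" for B L K X
  proof -
    let ?Z = "outputs (B L) X" and ?R = "listing u K"
    have Z: "inj ?Z" "\<And>n. ?Z n \<notin> X ` {..n}" using run[OF that] by auto
    have densZ: "ereal (\<alpha> / 2) \<le> set_density u (range ?Z) K"
      using kw L K X assms(2) by (auto simp: kleinberg_wei_def)
    \<comment> \<open>The position of \<open>K\<close> in the collection determines the constant
      \<open>2 ^ Suc i\<close> in the schedule condition. The zero-based element \<open>j\<close>
      has deadline \<open>D (Suc j)\<close>.\<close>
    obtain i where i: "K = L i" using K by blast
    have "\<forall>\<^sub>F j in sequentially. s (2 ^ Suc i * Suc j) \<le> D (Suc j)"
      using early[of "2 ^ Suc i"] by (subst eventually_sequentially_Suc)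
    then have met: "\<forall>\<^sub>F j in sequentially. \<forall>n. n \<notin> range (?e \<omega>) \<longrightarrow> ?Z n = ?R j \<longrightarrow>
        ?R j \<in> outputs (A L (B L) \<omega>) X ` {..<D (Suc j)}" for \<omega>
    proof eventually_elim
      case (elim j)
      then show ?case
        using deadline_met[OF assms(1) L bt _ Z(2)] unfolding A_def i by blast
    qed
    \<comment> \<open>By injectivity at most \<open>n\<close> steps of the black box output one of
      the first \<open>n\<close> elements. These steps are determined by \<open>B\<close>,
      \<open>L\<close> and \<open>X\<close> and do not involve \<open>\<omega>\<close>.\<close>
    have "card (?Z -` ?R ` {..<n}) \<le> n" for n
    proof -
      have "card (?Z -` ?R ` {..<n}) \<le> card (?R ` {..<n})"
        using Z(1) by (intro card_inj_on_le[of ?Z]) (auto intro: inj_on_subset)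
      also have "\<dots> \<le> n" using card_image_le[of "{..<n}" ?R] by simp
      finally show ?thesis .
    qed
    moreover have "finite (?Z -` ?R ` {..<n})" for n
      by (intro finite_vimageI Z(1)) simp
    ultimately have "AE \<omega> in ?M.
        (\<lambda>n. real (card {k. ?e \<omega> k \<in> ?Z -` ?R ` {..<n}}) / real n) \<longlonglongrightarrow> 0"
      by (intro AE_explorations_negligible mono long)
    then show ?thesis
      by eventually_elim (rule deadline_density_liminf[OF Z(1) inj_e densZ _ met])
  qed
  have rate: "\<forall>\<^sub>F t in sequentially.
      (SUP K\<in>range L. SUP X\<in>{X \<in> part_enum u \<alpha> K. consistent_from (B L) X K T}.
         ereal (hallucination_rate ?M (A L (B L)) K X t)) \<le> ereal (H t)"
    if kw: "kleinberg_wei u B" and L: "collection L" for B L T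
    using schedule_budget[OF s, of T]
  proof eventually_elim
    case (elim t)
    have "hallucination_rate ?M (A L (B L)) K X t \<le> real (card {k. s k < t} + T) / real t"
      if K: "K \<in> range L" and X: "X \<in> part_enum u \<alpha> K" and T: "consistent_from (B L) X K T" for K X
      unfolding hallucination_rate_def
    proof (rule integral_le_bound)
      fix \<omega>
      let ?S = "outputs (A L (B L) \<omega>) X"
      have Z: "inj (outputs (B L) X)" "\<And>n. outputs (B L) X n \<notin> X ` {..n}"
        using run[OF kw L K X] by auto
      have "first_n ?S t - K = ?S ` {n. n < t \<and> ?S n \<notin> K}" by (auto simp: first_n_def)
      then have "card (first_n ?S t - K) \<le> card {n. n < t \<and> ?S n \<notin> K}"
        by (simp add: card_image_le)
      also have "\<dots> \<le> card (range (?e \<omega>) \<inter> {..<t}) + T"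
        using T outputs_exploit[OF _ Z(2)] unfolding A_def
        by (intro card_hallucinations_le[OF Z(1)]) (auto simp: consistent_from_def)
      \<comment> \<open>An exploration never precedes the start of its block.\<close>
      also have "card (range (?e \<omega>) \<inter> {..<t}) \<le> card {k. s k < t}"
      proof (rule surj_card_le)
        show "finite {k. s k < t}"
          by (rule finite_subset[of _ "{..t}"])
            (auto intro: order_trans[OF strict_mono_imp_increasing[OF mono]])
        show "range (?e \<omega>) \<inter> {..<t} \<subseteq> ?e \<omega> ` {k. s k < t}"
          using bt[of \<omega>] by (auto simp: block_times_def intro: le_less_trans)
      qed
      finally show "real (card (first_n ?S t - K)) / real t \<le> real (card {k. s k < t} + T) / real t"
        by (intro divide_right_mono) simp_all
    qed simp
    then show ?case
      using elim by (intro SUP_least) (auto intro: order_trans)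
  qed
  have "black_box (\<lambda>b. A L b \<omega>)" for L \<omega>
    unfolding A_def by (rule black_box_greedy_mixed)
  then show ?thesis
    using rand dens rate by (intro exI[of _ ?M] exI[of _ A]) auto
qed

end
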